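(* For a polynomial $P$ let $D_P(X):=\#\bigl(\mathcal B^{\mathrm{bad}}(\mathscr Y_P)\cap[1,X]^2\bigr)$. (1) Let $P(T)\in\mathbb Z[T]$ be a monic polynomial of degree $d\ge2$ with nonnegative coefficients and $P(0)=0$, and suppose $P(T)\ne T^d$. Then $$D_P(X)\gg_P X.$$ (2) Let $P(T)=T^r(m+nT)$, where $r\ge2$, $m,n\ge1$ are integers and $\gcd(m,n)=1$. Then, for every $\varepsilon>0$, $$X\log X\ll_P D_P(X)\ll_{P,\varepsilon}X^{7/4+\varepsilon}.$$ If moreover $r=2$, so that $P(T)=T^2(m+nT)$, then $D_P(X)\ll_{P,\varepsilon}X^{5/3+\varepsilon}$.
   Context: For $P\in\mathbb Z[T]$ with $P(0)=0$ and nonnegative coefficients (nonzero), $\mathscr Y_P$ denotes the family of branches $\phi_q(t)=(t,qP(t))$, $q\in\mathbb Q_{>0}$. Its branch locus is $\mathcal B(\mathscr Y_P)=\{\phi_q(t)\in\mathbb Z^2:q\in\mathbb Q_{>0},\ t\in\mathbb R_{>0}\}$, and each of its points is $\phi_q(t)$ for a unique $(q,t)$. For $Q\in\mathbb Z^2$ and a prime $p$, $v_p(Q)=\min(v_p(Q_1),v_p(Q_2))$. A point $\phi_q(t)$ of the branch locus is globally visible if there is no $s$ with $0<s<t$ and $\phi_q(s)\in\mathbb Z^2$; it is $p$-adically visible if $v_p(\phi_q(t))\le v_p(\phi_q(s))$ for every $s$ with $0<s<t$ and $\phi_q(s)\in\mathbb Z^2$. The local defect set $\mathcal B^{\mathrm{bad}}(\mathscr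 Y_P)$ is the set of points of $\mathcal B(\mathscr Y_P)$ that are $p$-adically visible for every prime $p$ but not globally visible. Estimates $\ll,\gg$ are asserted for all sufficiently large $X$, with positive implied constants depending only on the subscripted quantities. *)

theory Defs
  imports
    "HOL-Computational_Algebra.Computational_Algebra"
    "HOL-Library.Extended_Nat"
    "HOL-Library.Landau_Symbols"
begin

definition branch :: "int poly \<Rightarrow> rat \<Rightarrow> real \<Rightarrow> real \<times> real" where
  "branch P q t = (t, of_rat q * poly (map_poly of_int P) t)"

definition lattice_point :: "int \<times> int \<Rightarrow> real \<times> real" where
  "lattice_point Q = (of_int (fst Q), of_int (snd Q))"

definition branch_locus :: "int poly \<Rightarrow> (int \<times> int) set" where
  "branch_locus P = {Q. \<exists>q>0. \<exists>t>0. branch P q t = lattice_point Q}"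

(* multiplicity p 0 = 0 in the library, whereas the valuation of 0 is infinite. *)
definition int_val :: "nat \<Rightarrow> int \<Rightarrow> enat" where
  "int_val p a = (if a = 0 then \<infinity> else enat (multiplicity (int p) a))"

definition point_val :: "nat \<Rightarrow> int \<times> int \<Rightarrow> enat" where
  "point_val p Q = min (int_val p (fst Q)) (int_val p (snd Q))"

(* Every point of the branch locus has exactly one pair of parameters (q, t), so the
   universal quantifiers over q and t below only name that pair; they do not range over
   several representations of Q.  Both notions are meant for points of the locus. *)
lemma branch_parameters_unique:
  assumes nonneg: "\<And>i. coeff P i \<ge> 0" and "P \<noteq> 0"
    and "t > 0" and "branch P q t = branch P q' t'"
  shows "q = q' \<and> t = t'"
proof -
  let ?R = "map_poly of_int P :: real poly"
  have t: "t = t'" and eq: "of_rat q * poly ?R t = of_rat q' * poly ?R t"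
    using assms(4) by (auto simp: branch_def)
  have "poly ?R t = (\<Sum>i\<le>degree P. of_int (coeff P i) * t ^ i)"
    by (simp add: poly_altdef coeff_map_poly degree_map_poly)
  also have "\<dots> > 0"
  proof (rule sum_pos2[where i = "degree P"])
    have "lead_coeff P > 0"
      using nonneg[of "degree P"] \<open>P \<noteq> 0\<close> by (simp add: order_less_le)
    then show "0 < of_int (lead_coeff P) * t ^ degree P"
      using \<open>t > 0\<close> by simp
  qed (use nonneg \<open>t > 0\<close> in auto)
  finally show ?thesis
    using t eq by simp
qed

definition globally_visible :: "int poly \<Rightarrow> int \<times> int \<Rightarrow> bool" where
  "globally_visible P Q \<longleftrightarrow>
    (\<forall>q>0. \<forall>t>0. branch P q t = lattice_point Q \<longrightarrow>
      \<not> (\<exists>s R. 0 < s \<and> s < t \<and> branch P q s = lattice_point R))"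

definition padically_visible :: "int poly \<Rightarrow> nat \<Rightarrow> int \<times> int \<Rightarrow> bool" where
  "padically_visible P p Q \<longleftrightarrow>
    (\<forall>q>0. \<forall>t>0. branch P q t = lattice_point Q \<longrightarrow>
      (\<forall>s R. 0 < s \<and> s < t \<and> branch P q s = lattice_point R \<longrightarrow>
        point_val p Q \<le> point_val p R))"

definition local_defect_set :: "int poly \<Rightarrow> (int \<times> int) set" where
  "local_defect_set P =
    {Q \<in> branch_locus P. (\<forall>p. prime p \<longrightarrow> padically_visible P p Q) \<and> \<not> globally_visible P Q}"

definition defect_count :: "int poly \<Rightarrow> real \<Rightarrow> nat" where
  "defect_count P X =
    card {(a, b) \<in> local_defect_set P. 1 \<le> a \<and> of_int a \<le> X \<and> 1 \<le> b \<and> of_int b \<le> X}"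

end

theory Submission
  imports Defs "HOL-Number_Theory.Totient" "HOL-Analysis.Harmonic_Numbers"
begin

text \<open>
  A point (a, b) with positive coordinates lies on the branch with q = b / P(a), and this branch has a
  lattice point over the integer s exactly if P(a) divides b P(s). The point is therefore invisible
  globally if such an s exists between 0 and a. It is visible at all primes exactly if g = gcd(a, b)
  divides s and b P(s) / P(a) for each such s.

  For the lower bounds take a and b coprime, so that g = 1 and only the existence of s matters. Write
  P = T^k R with R(0) nonzero. If a^k divides P(s) for some s < a, then every multiple b of R(a) that is
  prime to a gives a defect point (lemma \<open>coprime_defect_pointI\<close>). In the first part a single a
  is enough: a = s p, where p is a prime with p^k dividing R(s), provided by Hensel lifting in
  \<open>ex_prime_power_dvd_poly_value\<close>. For P = T^r (m + n T) whole progressions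
  are available: fix v > 1 prime to m and n, let u run through a progression on which v^r divides
  m + n u, and put a = u v, b = j (m + n a). The pairs (u, j) with u prime to j fill
  a positive proportion of a hyperbolic region, whence the logarithm; the weights totient(j) / j that arise from
  the coprimality are handled by \<open>sum_totient_div_square_ge\<close>.

  For the upper bound let (a, b) be a defect point, s an earlier abscissa, u = gcd(a, s), a = u v and s = u t. Dividing
  b P(s) = c P(a) by g, which divides c and s, and by u^r leaves a relation in which v is prime to
  everything on the left except m + n s. So m + n s = v^r z for some z, and then K = m + n a divides
  b t^r v^r z (\<open>defect_parametrisation\<close>). Given v, z and t, the value of a is determined, and
  b runs through the multiples of K / e, where e = gcd(K, t^r v^r z). Now e is at most K and at most
  m v^(r+1), because a common divisor of m + n u v and m + n u t almost divides v - t
  (\<open>gcd_linear_values_le\<close>). Interpolating between the two bounds, there are at most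
  m X Y^(2/3) / (v z) choices of b, where Y = m + n X bounds v^r z (\<open>gcd_ratio_le\<close>). The sum over v
  and z loses two logarithms, and t is a divisor of s, which costs Y^\<epsilon>. The total is X^(5/3 + \<epsilon>) for
  every r \<ge> 2, which is smaller than X^(7/4 + \<epsilon>).
\<close>

section \<open>Divisibility description of defect points\<close>

lemma poly_map_poly_of_int:
  "poly (map_poly of_int P) (of_int a) = (of_int (poly P a) :: 'a :: {comm_ring_1, ring_char_0})"
  by (induction P) (auto simp: map_poly_pCons)

lemma branch_eq_lattice_point_iff:
  "branch P q t = lattice_point (a, b) \<longleftrightarrow> t = of_int a \<and> q * of_int (poly P a) = of_int b"
proof -
  have "of_rat q * real_of_int (poly P a) = of_int b \<longleftrightarrow>
      (of_rat (q * of_int (poly P a)) :: real) = of_rat (of_int b)"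
    by (simp add: of_rat_mult)
  also have "\<dots> \<longleftrightarrow> q * of_int (poly P a) = of_int b"
    by (simp only: of_rat_eq_iff)
  finally show ?thesis
    by (auto simp: branch_def lattice_point_def poly_map_poly_of_int)
qed

text \<open>
  The parameter of the branch through (a, b) is q = b / P(a), so its height at s is an integer c
  precisely if b * P(s) = c * P(a). This turns every visibility question into a divisibility.
\<close>
lemma branch_meets_iff:
  fixes q :: rat
  assumes "poly P a > 0" "q * of_int (poly P a) = of_int b"
  shows "q * of_int (poly P s) = of_int c \<longleftrightarrow> b * poly P s = c * poly P a"
proof -
  have q: "q = of_int b / of_int (poly P a)"
    using assms by (simp add: field_simps)
  have "q * of_int (poly P s) = of_int c \<longleftrightarrow>
      (of_int (b * poly P s) :: rat) = of_int (c * poly P a)"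
    using assms(1) by (simp add: q field_simps)
  then show ?thesis
    by (simp only: of_int_eq_iff)
qed

text \<open>
  Points with coprime coordinates have valuation zero everywhere, the smallest possible value;
  hence they are visible at every prime.
\<close>
lemma coprime_imp_point_val_0:
  assumes "coprime a b" "prime p"
  shows "point_val p (a, b) = 0"
proof -
  have "\<not> int p dvd a \<or> \<not> int p dvd b"
    using assms by (meson not_prime_unit coprime_common_divisor prime_int_nat_transfer prime_nat_int_transfer)
  moreover have "int_val p c = 0" if "\<not> int p dvd c" for c
    using that by (auto simp: int_val_def not_dvd_imp_multiplicity_0 zero_enat_def)
  ultimately show ?thesis
    by (auto simp: point_val_def)
qed

text \<open>
  The valuations of a point are those of the gcd of its coordinates, so visibility at all primes
  at once is a divisibility by this gcd.
\<close>
lemma gcd_dvd_if_point_val_le: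
  assumes "a \<noteq> 0" "b \<noteq> 0" "c \<noteq> 0" "d \<noteq> 0"
    and "\<And>p. prime p \<Longrightarrow> point_val p (a, b) \<le> point_val p (c, d)"
  shows "gcd a b dvd c" "gcd a b dvd d"
proof -
  have *: "multiplicity p (gcd a b) \<le> multiplicity p c \<and> multiplicity p (gcd a b) \<le> multiplicity p d"
    if "prime p" for p
  proof -
    obtain k where k: "p = int k" "prime k"
      using \<open>prime p\<close> by (metis nat_0_le prime_ge_0_int prime_int_nat_transfer prime_nat_iff_prime)
    have "multiplicity p (gcd a b) \<le> multiplicity p a" "multiplicity p (gcd a b) \<le> multiplicity p b"
      using assms by (auto intro!: dvd_imp_multiplicity_le)
    then show ?thesis
      using assms(5)[OF k(2)] assms(1-4) by (auto simp: point_val_def int_val_def k min_def split: if_splits)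
  qed
  show "gcd a b dvd c" "gcd a b dvd d"
    by (rule multiplicity_le_imp_dvd; use * assms in auto)+
qed

text \<open>
  The source of all lower bounds: among coprime pairs, failing to be globally visible is all that a
  defect point has to do.
\<close>
lemma coprime_defect_pointI:
  assumes "0 < s" "s < a" "0 < b" "coprime a b" "poly P a > 0" "poly P a dvd b * poly P s"
  shows "(a, b) \<in> local_defect_set P"
proof -
  define q :: rat where "q = of_int b / of_int (poly P a)"
  have q: "q > 0" "q * of_int (poly P a) = of_int b"
    using assms by (auto simp: q_def)
  have on_branch: "branch P q (of_int a) = lattice_point (a, b)"
    using q by (simp add: branch_eq_lattice_point_iff)
  obtain c where "b * poly P s = c * poly P a"
    using assms(6) by (metis dvd_def mult.commute)
  then have "branch P q (of_int s) = lattice_point (s, c)"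
    using branch_meets_iff[OF assms(5) q(2)] by (simp add: branch_eq_lattice_point_iff)
  moreover have "0 < real_of_int s" "real_of_int s < real_of_int a" "0 < real_of_int a"
    using assms by auto
  ultimately have "\<not> globally_visible P (a, b)"
    unfolding globally_visible_def using q on_branch by blast
  moreover have "(a, b) \<in> branch_locus P"
    unfolding branch_locus_def using q on_branch \<open>0 < real_of_int a\<close> by blast
  moreover have "padically_visible P p (a, b)" if "prime p" for p
    by (simp add: padically_visible_def coprime_imp_point_val_0[OF assms(4) that])
  ultimately show ?thesis
    by (simp add: local_defect_set_def)
qed

text \<open>
  The source of the upper bound: all that is used of a defect point is one earlier lattice point
  (s, c) on its branch, whose coordinates inherit the factor gcd(a, b).
\<close>
lemma defect_pointE:
  assumes "(a, b) \<in> local_defect_set P" "0 < b" "\<And>t. 0 < t \<Longrightarrow> poly P t > 0"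
  obtains s c where "0 < s" "s < a" "b * poly P s = c * poly P a" "gcd a b dvd s" "gcd a b dvd c"
proof -
  obtain q t s R where q: "q > 0" "t > 0" "branch P q t = lattice_point (a, b)"
    and s: "0 < s" "s < t" "branch P q s = lattice_point R"
    using assms(1) by (auto simp: local_defect_set_def globally_visible_def)
  obtain s' c where R: "R = (s', c)"
    by (cases R)
  have t: "t = of_int a" "q * of_int (poly P a) = of_int b"
    and s': "s = of_int s'" "q * of_int (poly P s') = of_int c"
    using q s by (auto simp: branch_eq_lattice_point_iff R)
  have pos: "0 < s'" "s' < a"
    using s q by (auto simp: t s')
  then have P: "poly P a > 0" "poly P s' > 0"
    using assms(3) by auto
  have eq: "b * poly P s' = c * poly P a"
    using branch_meets_iff[OF P(1) t(2)] s' by simp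
  then have "c > 0"
    using P \<open>0 < b\<close> by (metis mult_pos_pos zero_less_mult_pos2)
  have "point_val p (a, b) \<le> point_val p (s', c)" if "prime p" for p
    using assms(1) that q s unfolding local_defect_set_def padically_visible_def R by blast
  then have "gcd a b dvd s'" "gcd a b dvd c"
    using gcd_dvd_if_point_val_le[of a b s' c] pos \<open>c > 0\<close> \<open>0 < b\<close> by auto
  then show thesis
    using that pos eq by blast
qed

text \<open>
  Infinite sets have cardinality zero, so finiteness is what allows
  lower bounds for the defect count to be read off from injections.
\<close>
lemma finite_defect_box:
  "finite {(a, b) \<in> local_defect_set P. 1 \<le> a \<and> of_int a \<le> X \<and> 1 \<le> b \<and> of_int b \<le> (X::real)}"
proof (rule finite_subset)
  show "{(a, b) \<in> local_defect_set P. 1 \<le> a \<and> of_int a \<le> X \<and> 1 \<le> b \<and> of_int b \<le> X}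
      \<subseteq> {1..\<lfloor>X\<rfloor>} \<times> {1..\<lfloor>X\<rfloor>}"
    by (auto simp: le_floor_iff)
qed simp

lemma card_le_defect_count:
  assumes "inj_on f I"
    and "\<And>i. i \<in> I \<Longrightarrow> f i \<in> {(a, b) \<in> local_defect_set P. 1 \<le> a \<and> of_int a \<le> X \<and> 1 \<le> b \<and> of_int b \<le> X}"
  shows "card I \<le> defect_count P X"
  unfolding defect_count_def
  using assms(2) by (intro card_inj_on_le[OF assms(1) _ finite_defect_box] image_subsetI)

section \<open>Prime powers dividing polynomial values\<close>

text \<open>
  Taylor expansion to first order, with a remainder that stays in the ring.
\<close>
lemma poly_taylor_quadratic:
  fixes F :: "'a :: idom poly"
  shows "\<exists>r. poly F (x + y) = poly F x + y * poly (pderiv F) x + y ^ 2 * r"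
proof (induction F)
  case 0
  show ?case
    by (rule exI[of _ 0]) simp
next
  case (pCons a F)
  then obtain r where r: "poly F (x + y) = poly F x + y * poly (pderiv F) x + y ^ 2 * r"
    by blast
  show ?case
    by (rule exI[of _ "poly (pderiv F) x + (x + y) * r"])
      (simp add: pderiv_pCons r algebra_simps power2_eq_square)
qed

text \<open>
  One step of Hensel lifting. The correction of s is a multiple of c * p^j, which keeps the residue
  class modulo c; since p does not divide c * F'(s), some multiple kills the next p-adic digit of F(s).
\<close>
lemma hensel_step:
  fixes p s c :: int and F :: "int poly"
  assumes "prime p" "\<not> p dvd c" "\<not> p dvd poly (pderiv F) s" "p ^ j dvd poly F s" "j \<ge> 1"
  obtains s' where "[s' = s] (mod c)" "p ^ Suc j dvd poly F s'"
proof -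
  obtain f where f: "poly F s = p ^ j * f"
    using assms(4) by blast
  let ?d = "c * poly (pderiv F) s"
  have "coprime ?d p"
    using assms(1-3) by (metis coprime_commute prime_dvd_mult_iff prime_imp_coprime)
  then obtain e where e: "[?d * e = 1] (mod p)"
    using cong_solve_coprime_int by blast
  define i where "i = - f * e"
  have "[f + i * ?d = f + (- f) * 1] (mod p)"
    unfolding i_def using cong_add[OF cong_refl[of f] cong_mult[OF cong_refl[of "- f"] e]]
    by (simp add: mult_ac)
  then have "p dvd f + i * ?d"
    by (simp add: cong_0_iff)
  then have 1: "p ^ Suc j dvd p ^ j * (f + i * ?d)"
    by (metis mult_dvd_mono dvd_refl power_Suc2)
  obtain r where "poly F (s + c * p ^ j * i) =
      poly F s + (c * p ^ j * i) * poly (pderiv F) s + (c * p ^ j * i) ^ 2 * r"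
    using poly_taylor_quadratic by blast
  then have "poly F (s + c * p ^ j * i) = p ^ j * (f + i * ?d) + p ^ (2 * j) * (c * i) ^ 2 * r"
    by (simp add: f algebra_simps power_mult_distrib power_mult power2_eq_square power_add mult_2)
  moreover have "p ^ Suc j dvd p ^ (2 * j) * (c * i) ^ 2 * r"
    using assms(5) by (intro dvd_mult2 le_imp_power_dvd) auto
  ultimately have "p ^ Suc j dvd poly F (s + c * p ^ j * i)"
    using 1 by simp
  moreover have "[s + c * p ^ j * i = s] (mod c)"
    by (simp add: cong_iff_dvd_diff mult.assoc)
  ultimately show thesis
    using that by blast
qed

text \<open>
  A substitute for the gcd of F and F' over the rationals: a nonzero element H of least degree in
  the ideal (F, F') of Z[T]. The pseudo-remainder of F by H lies in the ideal and has smaller degree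
  than H, hence vanishes, so H divides F up to the constant a.
\<close>
lemma poly_common_pseudo_divisor:
  fixes F :: "int poly"
  assumes "degree F \<ge> 1"
  obtains A B H Q a where "H = A * F + B * pderiv F" "H \<noteq> 0" "degree H < degree F"
    "a \<noteq> 0" "smult a F = H * Q"
proof -
  define I where "I = {A * F + B * pderiv F | A B. True}"
  have nz: "pderiv F \<noteq> 0"
    using assms by (simp add: pderiv_eq_0_iff)
  have "F \<in> I"
    unfolding I_def by (rule CollectI, intro exI[of _ 1] exI[of _ 0]) simp
  have "pderiv F \<in> I"
    unfolding I_def by (rule CollectI, intro exI[of _ 0] exI[of _ 1]) simp
  obtain H where H: "H \<in> I" "H \<noteq> 0" and min: "\<And>G. G \<in> I \<Longrightarrow> G \<noteq> 0 \<Longrightarrow> degree H \<le> degree G"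
    using ex_has_least_nat[of "\<lambda>H. H \<in> I \<and> H \<noteq> 0" "pderiv F" degree] nz \<open>pderiv F \<in> I\<close> by blast
  obtain A B where AB: "H = A * F + B * pderiv F"
    using H unfolding I_def by blast
  obtain a Q where aQ: "a \<noteq> 0" "smult a F = H * Q + pseudo_mod F H"
    using pseudo_mod(1)[OF H(2)] by blast
  have "pseudo_mod F H = [:a:] * F - H * Q"
    using aQ by simp
  also have "\<dots> = ([:a:] - A * Q) * F + (- B * Q) * pderiv F"
    by (simp add: AB algebra_simps)
  finally have "pseudo_mod F H \<in> I"
    unfolding I_def by blast
  then have "pseudo_mod F H = 0"
    using pseudo_mod(2)[OF H(2), of F] min[of "pseudo_mod F H"] by (meson not_less)
  moreover have "degree H < degree F"
    using min[OF \<open>pderiv F \<in> I\<close> nz] assms by (simp add: degree_pderiv)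
  ultimately show thesis
    using that[OF AB H(2) _ aQ(1), of Q] aQ(2) by (simp only: add_0_right)
qed

lemma ex_large_poly_value:
  fixes F :: "int poly"
  assumes "degree F \<ge> 1" "e \<noteq> 0"
  obtains z where "poly F (1 + e * z) \<notin> {0, h, - h}"
proof -
  have "finite {x. poly (F - [:y:]) x = 0}" for y
  proof (rule poly_roots_finite)
    show "F - [:y:] \<noteq> 0"
      using assms(1) by (metis degree_pCons_0 eq_iff_diff_eq_0 not_one_le_zero)
  qed
  then have "finite {x. poly F x = y}" for y
    by simp
  then have "finite {x. poly F x \<in> {0, h, - h}}"
    by (simp add: Collect_disj_eq)
  moreover have "infinite (range (\<lambda>z. 1 + e * z))"
    using assms(2) by (subst finite_image_iff) (auto simp: inj_on_def infinite_UNIV_int)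
  ultimately obtain x where "x \<in> range (\<lambda>z. 1 + e * z)" "x \<notin> {x. poly F x \<in> {0, h, - h}}"
    by (meson finite_subset subsetI)
  then show thesis
    using that by blast
qed

lemma poly_diff_dvd: "x - y dvd poly F x - poly F (y :: int)"
proof -
  obtain r where "poly F (y + (x - y)) = poly F y + (x - y) * poly (pderiv F) y + (x - y) ^ 2 * r"
    using poly_taylor_quadratic by blast
  then have "poly F x - poly F y = (x - y) * (poly (pderiv F) y + (x - y) * r)"
    by (simp add: algebra_simps power2_eq_square)
  then show ?thesis
    by simp
qed

text \<open>
  Euclid's argument for polynomial values. With h = F(1), the value of F at 1 + c h z is
  h (1 + c w) for some w; for all but finitely many z the factor 1 + c w is neither zero nor a
  unit, and its prime factors cannot divide c.
\<close>
lemma ex_prime_dvd_poly_value: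
  fixes F :: "int poly"
  assumes "degree F \<ge> 1" "c \<noteq> 0" "poly F 1 \<noteq> 0"
  obtains p s where "prime p" "\<not> p dvd c" "[s = 1] (mod c)" "p dvd poly F s"
proof -
  define h where "h = poly F 1"
  obtain z where z: "poly F (1 + (c * h) * z) \<notin> {0, h, - h}"
    using ex_large_poly_value[of F "c * h" h] assms by (auto simp: h_def)
  let ?s = "1 + (c * h) * z"
  have "c * h * z dvd poly F ?s - h"
    using poly_diff_dvd[of ?s 1 F] by (simp add: h_def)
  then obtain w where "poly F ?s - h = c * h * z * w"
    by blast
  then have w: "poly F ?s = h * (1 + c * (z * w))"
    by (simp add: algebra_simps)
  have "\<bar>1 + c * (z * w)\<bar> \<noteq> 1"
  proof
    assume "\<bar>1 + c * (z * w)\<bar> = 1"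
    then have "1 + c * (z * w) = 1 \<or> 1 + c * (z * w) = -1"
      by linarith
    then have "poly F ?s = h \<or> poly F ?s = - h"
      unfolding w by (metis mult.right_neutral mult_minus_right)
    with z show False
      by blast
  qed
  then have "\<not> is_unit (1 + c * (z * w))"
    by simp
  moreover have "1 + c * (z * w) \<noteq> 0"
    using w z by auto
  ultimately obtain p where p: "prime p" "p dvd 1 + c * (z * w)"
    using prime_divisorE by blast
  show thesis
  proof (rule that[OF p(1)])
    show "\<not> p dvd c"
    proof
      assume "p dvd c"
      then have "p dvd (1 + c * (z * w)) - c * (z * w)"
        using p(2) by (intro dvd_diff) auto
      then show False
        using p(1) by auto
    qed
    show "[?s = 1] (mod c)"
      by (simp add: cong_iff_dvd_diff mult.assoc)
    show "p dvd poly F ?s"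
      using p(2) by (simp add: w)
  qed
qed

text \<open>
  Induction on the degree, through the element H of the ideal (F, F'). If H is not constant,
  then it is a divisor of F up to a constant and has smaller degree, so the induction hypothesis
  applies to it once the constant is added to the numbers that p has to avoid. If H = D is a
  nonzero constant, then a prime p that divides F(s) but not D cannot divide F'(s), and the zero of F modulo p
  lifts to all powers of p.
\<close>
lemma ex_prime_power_dvd_poly_value:
  fixes F :: "int poly"
  assumes "degree F \<ge> 1" "c \<noteq> 0" "poly F 1 \<noteq> 0"
  shows "\<exists>p s. prime p \<and> \<not> p dvd c \<and> [s = 1] (mod c) \<and> p ^ k dvd poly F s"
  using assms
proof (induction "degree F" arbitrary: F c rule: less_induct)
  case less
  obtain A B H Q a where H: "H = A * F + B * pderiv F" "H \<noteq> 0" "degree H < degree F"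
    and a: "a \<noteq> 0" "smult a F = H * Q"
    by (rule poly_common_pseudo_divisor[OF less.prems(1)])
  have aF: "a * poly F x = poly H x * poly Q x" for x
    using arg_cong[OF a(2), of "\<lambda>G. poly G x"] by (simp only: poly_smult poly_mult)
  show ?case
  proof (cases "degree H \<ge> 1")
    case True
    have "poly H 1 \<noteq> 0"
      using aF[of 1] a less.prems by auto
    then obtain p s where p: "prime p" "\<not> p dvd c * a" "[s = 1] (mod c * a)" "p ^ k dvd poly H s"
      using less.hyps[OF H(3) True, of "c * a"] a less.prems by auto
    have "p ^ k dvd a * poly F s"
      using p(4) by (simp add: aF)
    moreover have "coprime (p ^ k) a"
      using p by (metis coprime_power_left_iff dvd_mult prime_imp_coprime)
    ultimately have "p ^ k dvd poly F s"
      by (simp add: coprime_dvd_mult_right_iff)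
    moreover have "[s = 1] (mod c)"
      using p(3) by (rule cong_dvd_modulus) simp
    ultimately show ?thesis
      using p by (metis dvd_mult2)
  next
    case False
    then obtain D where D: "H = [:D:]"
      by (metis degree_eq_zeroE less_one not_less)
    then have "D \<noteq> 0"
      using H(2) by simp
    have bezout: "D = poly A x * poly F x + poly B x * poly (pderiv F) x" for x
      using arg_cong[OF H(1), of "\<lambda>G. poly G x"] by (simp only: D poly_add poly_mult) simp
    \<comment> \<open>Avoiding D as well as c makes every zero of F modulo p a simple one.\<close>
    obtain p s0 where p: "prime p" "\<not> p dvd c * D" "[s0 = 1] (mod c * D)" "p dvd poly F s0"
      using ex_prime_dvd_poly_value[of F "c * D"] less.prems \<open>D \<noteq> 0\<close> by auto
    have "\<exists>s. [s = 1] (mod c) \<and> p ^ Suc j dvd poly F s" for j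
    proof (induction j)
      case 0
      have "[s0 = 1] (mod c)"
        using p(3) by (rule cong_dvd_modulus) simp
      then show ?case
        using p(4) by auto
    next
      case (Suc j)
      then obtain s where s: "[s = 1] (mod c)" "p ^ Suc j dvd poly F s"
        by blast
      have "p dvd poly F s"
        using s(2) by (metis dvd_mult_left power_Suc)
      have "\<not> p dvd poly (pderiv F) s"
      proof
        assume "p dvd poly (pderiv F) s"
        with \<open>p dvd poly F s\<close> have "p dvd D"
          unfolding bezout[of s] by auto
        with p(2) show False
          by simp
      qed
      moreover have "\<not> p dvd c"
        using p(2) by auto
      ultimately obtain s' where "[s' = s] (mod c)" "p ^ Suc (Suc j) dvd poly F s'"
        using hensel_step[OF p(1) _ _ s(2)] by auto
      then show ?case
        using s(1) cong_trans by blast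
    qed
    then obtain s where s: "[s = 1] (mod c)" "p ^ Suc k dvd poly F s"
      by blast
    then have "p ^ k dvd poly F s"
      by (metis dvd_mult_right power_Suc)
    then show ?thesis
      using p s(1) by (metis dvd_mult2)
  qed
qed

section \<open>The linear lower bound\<close>

lemma poly_pos_of_nonneg_coeffs:
  fixes P :: "int poly"
  assumes "\<And>i. coeff P i \<ge> 0" "P \<noteq> 0" "0 < t"
  shows "poly P t > 0"
proof -
  have "lead_coeff P > 0"
    using assms(1)[of "degree P"] assms(2) by (simp add: order_less_le)
  have "0 < lead_coeff P * t ^ degree P"
    using \<open>lead_coeff P > 0\<close> assms(3) by simp
  also have "\<dots> \<le> (\<Sum>i\<le>degree P. coeff P i * t ^ i)"
    by (rule member_le_sum) (use assms in auto)
  finally show ?thesis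
    by (simp add: poly_altdef)
qed

text \<open>
  Modulo a, the value R(a) is R(0).
\<close>
lemma coprime_poly_value:
  fixes R :: "int poly"
  assumes "coprime a (poly R 0)"
  shows "coprime a (poly R a)"
proof (rule coprimeI)
  fix d assume d: "d dvd a" "d dvd poly R a"
  have "a dvd poly R a - poly R 0"
    using poly_diff_dvd[of a 0 R] by simp
  then have "d dvd poly R a - poly R 0"
    using d dvd_trans by blast
  with d(2) have "d dvd poly R a - (poly R a - poly R 0)"
    by (rule dvd_diff)
  then have "d dvd poly R 0"
    by simp
  then show "is_unit d"
    using assms d coprime_common_divisor by blast
qed

text \<open>
  One abscissa a suffices. Take a = s p with p^k dividing R(s) and a prime to R(0). Then a^k divides
  P(s) = s^k R(s), so every multiple b of R(a) has P(a) dividing b P(s). The multiples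
  b = R(a) (1 + a i) are moreover prime to a, and there are about X / (a R(a)) of them up to X.
\<close>
lemma linear_lower_bound:
  fixes R :: "int poly"
  assumes coeffs: "\<And>i. coeff R i \<ge> 0" and "degree R \<ge> 1" "poly R 0 \<noteq> 0"
  shows "(\<lambda>X. real (defect_count (monom 1 k * R) X)) \<in> \<Omega>[at_top](\<lambda>X. X)"
proof -
  define c where "c = poly R 0"
  have pos: "poly R t > 0" if "t > 0" for t
    using poly_pos_of_nonneg_coeffs[OF coeffs _ that] assms(2) by fastforce
  obtain p s0 where p: "prime p" "\<not> p dvd c" "[s0 = 1] (mod c)" "p ^ k dvd poly R s0"
    using ex_prime_power_dvd_poly_value[of R c k] pos[of 1] assms(2,3) by (auto simp: c_def)
  \<comment> \<open>Shifting \<open>s0\<close> by a multiple of c * p^k makes it positive without changing the congruences.\<close>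
  define E where "E = \<bar>c * p ^ k\<bar> * (\<bar>s0\<bar> + 1)"
  define s where "s = s0 + E"
  have "p > 1"
    using p(1) by (simp add: prime_gt_1_int)
  have "c \<noteq> 0"
    using assms by (simp add: c_def)
  have "\<bar>c * p ^ k\<bar> \<ge> 1"
  proof -
    have "c * p ^ k \<noteq> 0"
      using \<open>c \<noteq> 0\<close> \<open>p > 1\<close> by simp
    then show ?thesis
      by linarith
  qed
  then have "1 * (\<bar>s0\<bar> + 1) \<le> E"
    unfolding E_def by (intro mult_right_mono) auto
  then have "s > 0"
    unfolding s_def using abs_ge_minus_self[of s0] by simp
  have diff: "c dvd s - s0" "p ^ k dvd s - s0"
    by (auto simp: s_def E_def intro!: dvd_mult2)
  have "p ^ k dvd poly R s - poly R s0"
    using diff(2) poly_diff_dvd dvd_trans by blast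
  then have "p ^ k dvd poly R s"
    using p(4) by (metis diff_add_cancel dvd_add)
  have "[s = 1] (mod c)"
    using diff(1) p(3) by (metis cong_iff_dvd_diff cong_trans)
  then have "coprime s c"
    by (metis cong_imp_coprime cong_sym coprime_1_left)
  define a where "a = s * p"
  have "coprime p c"
    using p by (simp add: prime_imp_coprime)
  then have "coprime a c"
    using \<open>coprime s c\<close> by (simp add: a_def)
  then have "coprime a (poly R a)"
    by (intro coprime_poly_value) (simp add: c_def)
  have "s < a"
    using \<open>p > 1\<close> \<open>s > 0\<close> by (simp add: a_def)
  then have "a > 0"
    using \<open>s > 0\<close> by simp
  have "poly R a > 0"
    using pos \<open>a > 0\<close> by blast
  define B where "B = poly R a"
  define f where "f i = (a, B * (1 + a * int i))" for i :: nat
  have defect: "f i \<in> local_defect_set (monom 1 k * R)" for i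
    unfolding f_def
  proof (rule coprime_defect_pointI[of s])
    show "0 < B * (1 + a * int i)"
      using \<open>a > 0\<close> \<open>poly R a > 0\<close> by (simp add: B_def add_pos_nonneg)
    have "coprime a (1 + a * int i)"
      by (rule coprimeI) (metis dvd_add_left_iff dvd_mult2)
    then show "coprime a (B * (1 + a * int i))"
      using \<open>coprime a (poly R a)\<close> by (simp add: B_def)
    show "poly (monom 1 k * R) a > 0"
      using \<open>a > 0\<close> \<open>poly R a > 0\<close> by (simp add: poly_monom)
    have "a ^ k dvd s ^ k * poly R s"
      unfolding a_def power_mult_distrib using \<open>p ^ k dvd poly R s\<close> by (intro mult_dvd_mono) auto
    then have "a ^ k * B dvd (s ^ k * poly R s) * (B * (1 + a * int i))"
      by (intro mult_dvd_mono) auto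
    then show "poly (monom 1 k * R) a dvd B * (1 + a * int i) * poly (monom 1 k * R) s"
      by (simp add: poly_monom B_def mult_ac)
  qed fact+
  have "a \<ge> 1" "B \<ge> 1"
    using \<open>a > 0\<close> \<open>poly R a > 0\<close> by (auto simp: B_def)
  show ?thesis
  proof (rule landau_omega.bigI)
    define C where "C = real_of_int (B * (1 + a))"
    have "C > 0"
      using \<open>a \<ge> 1\<close> \<open>B \<ge> 1\<close> by (simp add: C_def)
    show "1 / (2 * C) > 0"
      using \<open>C > 0\<close> by simp
    show "\<forall>\<^sub>F X in at_top. norm (real (defect_count (monom 1 k * R) X)) \<ge> 1 / (2 * C) * norm X"
      using eventually_ge_at_top[of "max (2 * C) (real_of_int a)"]
    proof eventually_elim
      case (elim X)
      define N where "N = nat \<lfloor>X / C\<rfloor>"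
      have "X / C \<ge> 1"
        using elim \<open>C > 0\<close> by (simp add: field_simps)
      have N: "real N \<le> X / C" "X / C - 1 \<le> real N"
        using \<open>X / C \<ge> 1\<close> by (auto simp: N_def)
      have "N = card {..<N}"
        by simp
      also have "card {..<N} \<le> defect_count (monom 1 k * R) X"
      proof (rule card_le_defect_count)
        show "inj_on f {..<N}"
          using \<open>a \<ge> 1\<close> \<open>B \<ge> 1\<close> by (auto simp: inj_on_def f_def)
        fix i assume i: "i \<in> {..<N}"
        have "1 * 1 \<le> B * (1 + a * int i)"
          using \<open>a \<ge> 1\<close> \<open>B \<ge> 1\<close> by (intro mult_mono) auto
        moreover have "real_of_int (B * (1 + a * int i)) \<le> X"
        proof -
          have "1 + a * int i \<le> (1 + a) * int N"
          proof -
            have "1 + a * int i \<le> int N + a * int N"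
              using i \<open>a \<ge> 1\<close> by (intro add_mono mult_left_mono) auto
            then show ?thesis
              by (simp add: algebra_simps)
          qed
          then have "B * (1 + a * int i) \<le> B * ((1 + a) * int N)"
            using \<open>B \<ge> 1\<close> by (intro mult_left_mono) auto
          then have "real_of_int (B * (1 + a * int i)) \<le> real_of_int (B * ((1 + a) * int N))"
            by (simp only: of_int_le_iff)
          also have "\<dots> = C * real N"
            by (simp add: C_def)
          also have "\<dots> \<le> X"
            using N(1) \<open>C > 0\<close> by (simp add: field_simps)
          finally show ?thesis .
        qed
        ultimately show "f i \<in> {(a, b) \<in> local_defect_set (monom 1 k * R).
            1 \<le> a \<and> of_int a \<le> X \<and> 1 \<le> b \<and> of_int b \<le> X}"
          using defect[of i] \<open>a \<ge> 1\<close> elim by (simp add: f_def)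
      qed
      finally have "real N \<le> real (defect_count (monom 1 k * R) X)"
        by simp
      moreover have "X / (2 * C) \<le> X / C - 1"
        using elim \<open>C > 0\<close> by (simp add: field_simps)
      ultimately show ?case
        using N(2) elim \<open>C > 0\<close> by simp
    qed
  qed
qed

lemma split_off_monomial:
  fixes P :: "int poly"
  assumes "P \<noteq> 0"
  obtains k R where "P = monom 1 k * R" "poly R 0 \<noteq> 0"
proof -
  obtain R where R: "P = [:- 0, 1:] ^ order 0 P * R" "\<not> [:- 0, 1:] dvd R"
    using order_decomp[OF assms] by blast
  then have "P = monom 1 (order 0 P) * R"
    by (simp add: monom_altdef)
  moreover have "poly R 0 \<noteq> 0"
    using R(2) by (metis poly_eq_0_iff_dvd)
  ultimately show thesis
    using that by blast
qed

lemma linear_lower_bound_monic: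
  fixes P :: "int poly"
  assumes "lead_coeff P = 1" "\<And>i. coeff P i \<ge> 0" "P \<noteq> monom 1 (degree P)"
  shows "(\<lambda>X. real (defect_count P X)) \<in> \<Omega>[at_top](\<lambda>X. X)"
proof -
  have "P \<noteq> 0"
    using assms(1) by auto
  obtain k R where R: "P = monom 1 k * R" "poly R 0 \<noteq> 0"
    using split_off_monomial[OF \<open>P \<noteq> 0\<close>] .
  have coeff_R: "coeff R i = coeff P (i + k)" for i
    by (simp add: R(1) coeff_monom_mult)
  have "degree R \<ge> 1"
  proof (rule ccontr)
    assume "\<not> degree R \<ge> 1"
    then obtain d where d: "R = [:d:]"
      by (metis degree_eq_zeroE less_one not_less)
    then have "P = monom d k"
      by (simp add: R(1) smult_monom)
    moreover from this have "d = 1" "degree P = k"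
      using assms(1) \<open>P \<noteq> 0\<close> by (auto simp: degree_monom_eq)
    ultimately show False
      using assms(3) by simp
  qed
  then show ?thesis
    using linear_lower_bound[of R k] assms(2) coeff_R R by simp
qed

section \<open>Totients and progressions\<close>

text \<open>
  As i runs over a full period modulo j, so does u + M i, because M is invertible modulo j.
\<close>
lemma card_coprime_shifted_multiples:
  fixes u M j :: nat
  assumes "coprime j M"
  shows "card {i. i < j \<and> coprime (u + M * i) j} = totient j"
proof (cases "j = 0")
  case False
  then have "j > 0"
    by simp
  let ?f = "\<lambda>i. (u + M * i) mod j"
  have inj: "inj_on ?f {..<j}"
  proof (rule inj_onI)
    fix x y assume xy: "x \<in> {..<j}" "y \<in> {..<j}" "?f x = ?f y"
    then have "[u + M * x = u + M * y] (mod j)"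
      by (simp add: cong_def)
    then have "[M * x = M * y] (mod j)"
      by (simp add: cong_add_lcancel_nat)
    then have "[x = y] (mod j)"
      using assms by (simp add: cong_mult_lcancel_nat coprime_commute)
    then show "x = y"
      using xy by (simp add: cong_less_modulus_unique_nat)
  qed
  then have surj: "?f ` {..<j} = {..<j}"
    using \<open>j > 0\<close> by (intro endo_inj_surj) auto
  have "bij_betw ?f {i. i < j \<and> coprime (u + M * i) j} {k. k < j \<and> coprime k j}"
  proof (rule bij_betw_imageI)
    show "inj_on ?f {i. i < j \<and> coprime (u + M * i) j}"
      using inj by (rule inj_on_subset) auto
    have cop: "coprime (?f i) j \<longleftrightarrow> coprime (u + M * i) j" for i
      using \<open>j > 0\<close> by (simp add: coprime_mod_left_iff)
    show "?f ` {i. i < j \<and> coprime (u + M * i) j} = {k. k < j \<and> coprime k j}"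
    proof (intro equalityI subsetI)
      fix k assume "k \<in> ?f ` {i. i < j \<and> coprime (u + M * i) j}"
      then show "k \<in> {k. k < j \<and> coprime k j}"
        using \<open>j > 0\<close> cop by auto
    next
      fix k assume k: "k \<in> {k. k < j \<and> coprime k j}"
      then obtain i where "i < j" "k = ?f i"
        using surj by (metis (no_types, lifting) imageE lessThan_iff mem_Collect_eq)
      then show "k \<in> ?f ` {i. i < j \<and> coprime (u + M * i) j}"
        using k cop by auto
    qed
  qed
  then have "card {i. i < j \<and> coprime (u + M * i) j} = card {k. k < j \<and> coprime k j}"
    by (rule bij_betw_same_card)
  also have "\<dots> = totient j"
  proof (cases "j = 1")
    case True
    have "{k::nat. k < 1 \<and> coprime k 1} = {0}"
      by auto
    then show ?thesis
      by (simp add: True)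
  next
    case False
    then have "{k. k < j \<and> coprime k j} = totatives j"
      using \<open>j > 0\<close> by (auto simp: totatives_def intro: gr0I order_le_neq_trans)
    then show ?thesis
      by (simp add: totient_def)
  qed
  finally show ?thesis .
qed auto

lemma card_coprime_progression:
  fixes u M j q :: nat
  assumes "coprime j M"
  shows "card {i. i < q * j \<and> coprime (u + M * i) j} = q * totient j"
proof (induction q)
  case (Suc q)
  let ?S = "\<lambda>q. {i. i < q * j \<and> coprime (u + M * i) j}"
  let ?T = "{i. i < j \<and> coprime ((u + M * (q * j)) + M * i) j}"
  have "?S (Suc q) = ?S q \<union> (\<lambda>i. q * j + i) ` ?T"
  proof (intro equalityI subsetI)
    fix i assume i: "i \<in> ?S (Suc q)"
    show "i \<in> ?S q \<union> (\<lambda>i. q * j + i) ` ?T"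
    proof (cases "i < q * j")
      case False
      then have "i = q * j + (i - q * j)" "i - q * j \<in> ?T"
        using i by (auto simp: algebra_simps)
      then show ?thesis
        by blast
    qed (use i in auto)
  qed (auto simp: algebra_simps)
  moreover have "?S q \<inter> (\<lambda>i. q * j + i) ` ?T = {}"
    by auto
  moreover have "card ((\<lambda>i. q * j + i) ` ?T) = totient j"
    by (subst card_image) (auto simp: card_coprime_shifted_multiples[OF assms])
  moreover have "finite (?S q)" "finite ?T"
    by auto
  ultimately show ?case
    using Suc.IH by (simp add: card_Un_disjoint)
qed auto

lemma sum_inverse_squares_le_2: "(\<Sum>e=1..N. 1 / real e ^ 2) \<le> 2"
proof -
  have *: "(\<Sum>e=1..Suc k. 1 / real e ^ 2) \<le> 2 - 1 / real (Suc k)" for k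
  proof (induction k)
    case (Suc k)
    have "1 / real (Suc (Suc k)) ^ 2 \<le> 1 / (real (Suc k) * real (Suc (Suc k)))"
      by (intro divide_left_mono) (auto simp: power2_eq_square)
    also have "\<dots> = 1 / real (Suc k) - 1 / real (Suc (Suc k))"
      by (simp add: field_simps)
    finally show ?case
      using Suc.IH by simp
  qed simp
  show ?thesis
  proof (cases N)
    case (Suc k)
    show ?thesis
      unfolding Suc by (rule order_trans[OF *]) simp
  qed simp
qed

lemma sum_inverse_progression_ge:
  fixes M N :: nat
  assumes "M \<ge> 1" "N \<ge> 1"
  shows "(\<Sum>n | n \<in> {1..N} \<and> [n = 1] (mod M). 1 / real n) \<ge> ln (real N / real M) / real M"
proof -
  define K where "K = (N - 1) div M"
  have "N - 1 < M * (K + 1)"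
    using assms by (simp add: K_def dividend_less_times_div)
  then have "N \<le> M * (K + 1)"
    by linarith
  then have "real N / real M \<le> real (K + 1)"
    using assms by (simp add: field_simps flip: of_nat_mult of_nat_add of_nat_Suc)
  then have "ln (real N / real M) \<le> ln (real (K + 1) + 1)"
    using assms by (intro ln_mono) auto
  also have "\<dots> \<le> harm (K + 1)"
    by (rule ln_le_harm)
  finally have "ln (real N / real M) / real M \<le> harm (K + 1) / real M"
    by (simp add: divide_right_mono)
  also have "harm (K + 1) = (\<Sum>i<K + 1. 1 / real (i + 1))"
    by (simp add: harm_altdef inverse_eq_divide)
  also have "\<dots> / real M = (\<Sum>i<K + 1. 1 / (real M * real (i + 1)))"
    unfolding sum_divide_distrib by (simp add: mult.commute)
  also have "\<dots> \<le> (\<Sum>i<K + 1. 1 / real (1 + M * i))"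
  proof (rule sum_mono)
    fix i
    have "1 + M * i \<le> M * (i + 1)"
      using assms by simp
    then have "real (1 + M * i) \<le> real M * real (i + 1)"
      by (metis of_nat_le_iff of_nat_mult)
    moreover have "0 < real (1 + M * i)"
      by (simp only: of_nat_0_less_iff)
    ultimately show "1 / (real M * real (i + 1)) \<le> 1 / real (1 + M * i)"
      by (intro frac_le) auto
  qed
  also have "\<dots> = (\<Sum>n\<in>(\<lambda>i. 1 + M * i) ` {..<K + 1}. 1 / real n)"
    using assms by (subst sum.reindex) (auto simp: inj_on_def)
  also have "\<dots> \<le> (\<Sum>n | n \<in> {1..N} \<and> [n = 1] (mod M). 1 / real n)"
  proof (rule sum_mono2)
    show "(\<lambda>i. 1 + M * i) ` {..<K + 1} \<subseteq> {n. n \<in> {1..N} \<and> [n = 1] (mod M)}"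
    proof safe
      fix i assume "i < K + 1"
      then have "M * i \<le> M * K"
        by simp
      also have "\<dots> \<le> N - 1"
        by (simp add: K_def)
      finally show "1 + M * i \<in> {1..N}"
        using assms by simp
      have "[M * i = 0] (mod M)"
        by (simp add: cong_0_iff)
      from cong_add[OF cong_refl[of 1] this] show "[1 + M * i = 1] (mod M)"
        by simp
    qed
  qed auto
  finally show ?thesis .
qed

text \<open>
  Gauss' identity (the totients of the divisors of n add up to n) gives
  1 / n = \<Sum> (totient j / j^2) (1 / e^2), the sum being over the factorisations n = j e. Summing over
  n up to N with n = 1 modulo M, where all divisors are prime to M, bounds a harmonic sum
  by the product of the wanted sum and the convergent sum of the 1 / e^2.
\<close>
lemma sum_totient_div_square_ge:
  fixes M N :: nat
  assumes "M \<ge> 1" "N \<ge> 1"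
  shows "(\<Sum>j | j \<in> {1..N} \<and> coprime j M. real (totient j) / real j ^ 2) \<ge> ln (real N / real M) / (2 * real M)"
proof -
  let ?J = "{j. j \<in> {1..N} \<and> coprime j M}"
  let ?D = "{n. n \<in> {1..N} \<and> [n = 1] (mod M)}"
  let ?P = "?J \<times> {1..N}"
  let ?w = "\<lambda>(j, e). real (totient j) / real j ^ 2 * (1 / real e ^ 2)"
  have "ln (real N / real M) / real M \<le> (\<Sum>n\<in>?D. 1 / real n)"
    using sum_inverse_progression_ge[OF assms] .
  also have "\<dots> = (\<Sum>n\<in>?D. \<Sum>j | j dvd n. real (totient j) / real n ^ 2)"
  proof (rule sum.cong)
    fix n assume "n \<in> ?D"
    then have "n > 0"
      by simp
    have "(\<Sum>j | j dvd n. real (totient j)) = real n"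
      using arg_cong[OF totient_divisor_sum[of n], of real] by simp
    then show "1 / real n = (\<Sum>j | j dvd n. real (totient j) / real n ^ 2)"
      using \<open>n > 0\<close> by (simp add: power2_eq_square flip: sum_divide_distrib)
  qed simp
  also have "\<dots> = (\<Sum>(n, j)\<in>(SIGMA n:?D. {j. j dvd n}). real (totient j) / real n ^ 2)"
    by (rule sum.Sigma) (auto intro!: finite_divisors_nat)
  also have "\<dots> = (\<Sum>(n, j)\<in>(SIGMA n:?D. {j. j dvd n}). ?w (j, n div j))"
    by (rule sum.cong) (auto elim!: dvdE simp: power_mult_distrib)
  also have "\<dots> = sum ?w ((\<lambda>(n, j). (j, n div j)) ` (SIGMA n:?D. {j. j dvd n}))"
    by (subst sum.reindex) (auto simp: inj_on_def case_prod_unfold elim!: dvdE)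
  also have "\<dots> \<le> sum ?w ?P"
  proof (rule sum_mono2)
    show "(\<lambda>(n, j). (j, n div j)) ` (SIGMA n:?D. {j. j dvd n}) \<subseteq> ?P"
    proof safe
      fix n j :: nat
      assume n: "n \<in> {1..N}" "[n = 1] (mod M)" and "j dvd n"
      have "0 < n div j"
        using n \<open>j dvd n\<close> by (auto elim!: dvdE)
      moreover have "n div j \<le> n" "n \<le> N"
        using n by auto
      ultimately show "n div j \<in> {1..N}"
        by (auto simp del: div_le_dividend)
      show "j \<in> {1..N}"
        using n \<open>j dvd n\<close> by (auto dest: dvd_imp_le dvd_pos_nat)
      have "coprime n M"
        using n(2) by (metis cong_imp_coprime cong_sym coprime_1_left)
      then show "coprime j M"
        using \<open>j dvd n\<close> by (meson coprime_divisors dvd_refl)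
    qed
  qed auto
  also have "\<dots> = (\<Sum>j\<in>?J. real (totient j) / real j ^ 2) * (\<Sum>e=1..N. 1 / real e ^ 2)"
    by (simp add: sum_product sum.cartesian_product)
  also have "\<dots> \<le> (\<Sum>j\<in>?J. real (totient j) / real j ^ 2) * 2"
    by (intro mult_left_mono sum_inverse_squares_le_2 sum_nonneg) auto
  finally show ?thesis
    by simp
qed

section \<open>The lower bound X log X\<close>

lemma poly_monom_linear: "poly (monom 1 r * [:m, n:]) t = t ^ r * (m + n * (t::int))"
  by (simp add: poly_monom algebra_simps)

lemma coprime_linear_value:
  fixes a m n :: nat
  assumes "coprime a m"
  shows "coprime a (m + n * a)"
  using assms by (metis coprime_iff_gcd_eq_1 gcd.commute gcd_add_mult mult.commute add.commute)

text \<open>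
  Here s = u is the earlier abscissa: (u v)^r divides u^r (m + n u) since v^r divides m + n u, and
  the factor m + n u v is supplied by the ordinate. Coprimality of the coordinates reduces to that of
  u v with m and with j.
\<close>
lemma linear_family_defect:
  fixes m n r u v j :: nat
  assumes "0 < m" "0 < u" "1 < v" "0 < j" "v ^ r dvd m + n * u"
    and "coprime u m" "coprime v m" "coprime j u" "coprime j v"
  shows "(int (u * v), int (j * (m + n * (u * v)))) \<in> local_defect_set (monom 1 r * [:int m, int n:])"
proof (rule coprime_defect_pointI[of "int u"])
  let ?a = "u * v" and ?P = "monom 1 r * [:int m, int n:]"
  have P: "poly ?P (int x) = int (x ^ r * (m + n * x))" for x
    unfolding poly_monom_linear by simp
  show "0 < int u" "int u < int ?a" "0 < int (j * (m + n * ?a))"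
    using assms by (auto simp del: of_nat_mult of_nat_power of_nat_add)
  show "poly ?P (int ?a) > 0"
    unfolding P of_nat_0_less_iff using assms by simp
  have "coprime ?a (m + n * ?a)"
    using assms by (intro coprime_linear_value) auto
  then have "coprime ?a (j * (m + n * ?a))"
    using assms by (auto simp: coprime_commute)
  then show "coprime (int ?a) (int (j * (m + n * ?a)))"
    by (simp only: coprime_int_iff)
  have "?a ^ r dvd u ^ r * (m + n * u)"
    using assms by (simp add: power_mult_distrib)
  then have "?a ^ r * (m + n * ?a) dvd (u ^ r * (m + n * u)) * (j * (m + n * ?a))"
    by (intro mult_dvd_mono) auto
  then show "poly ?P (int ?a) dvd int (j * (m + n * ?a)) * poly ?P (int u)"
    unfolding P by (simp only: of_nat_mult[symmetric] int_dvd_int_iff mult.commute)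
qed

text \<open>
  The base v = m n + 1 is prime to both m and n. Modulo v^r the class of u has to be -m / n, and modulo m
  it is chosen to be 1; by the first congruence, a common factor of u and v would divide m.
\<close>
lemma ex_progression:
  fixes m n r :: nat
  assumes "0 < m" "0 < n"
  obtains v u where "1 < v" "coprime v m" "0 < u" "u \<le> v ^ r * m" "v ^ r dvd m + n * u"
    "coprime u (v ^ r * m)"
proof -
  define v where "v = m * n + 1"
  have "v > 1"
    using assms by (simp add: v_def)
  have v: "coprime v m" "coprime v n"
    unfolding v_def by (rule coprimeI; metis dvd_add_right_iff dvd_mult dvd_mult2)+
  obtain e where e: "[n * e = 1] (mod v ^ r)"
    using cong_solve_coprime_nat[of n "v ^ r"] v by (auto simp: coprime_commute)
  obtain x where x: "[x = e * (m * (v ^ r - 1))] (mod v ^ r)" "[x = 1] (mod m)"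
    using binary_chinese_remainder_nat[of "v ^ r" m] v by (metis coprime_power_left_iff)
  define M where "M = v ^ r * m"
  have "M > 0"
    using assms by (simp add: M_def v_def)
  \<comment> \<open>The representative of x between 1 and M: it has to be positive, hence M in place of 0.\<close>
  define u where "u = (if x mod M = 0 then M else x mod M)"
  have u_x: "[u = x] (mod M)"
    by (auto simp: u_def cong_def)
  have u: "0 < u" "u \<le> M"
    using \<open>M > 0\<close> by (auto simp: u_def less_imp_le)
  have "[u = x] (mod m)" "[u = x] (mod v ^ r)"
    using u_x by (auto intro: cong_dvd_modulus_nat simp: M_def)
  have u1: "[u = 1] (mod m)"
    using \<open>[u = x] (mod m)\<close> x(2) cong_trans by blast
  have "[u = e * (m * (v ^ r - 1))] (mod v ^ r)"
    using \<open>[u = x] (mod v ^ r)\<close> x(1) cong_trans by blast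
  then have "[n * u = n * (e * (m * (v ^ r - 1)))] (mod v ^ r)"
    by (rule cong_scalar_left)
  also have "n * (e * (m * (v ^ r - 1))) = (n * e) * (m * (v ^ r - 1))"
    by simp
  also have "[\<dots> = 1 * (m * (v ^ r - 1))] (mod v ^ r)"
    using e by (rule cong_scalar_right)
  finally have "[m + n * u = m + 1 * (m * (v ^ r - 1))] (mod v ^ r)"
    by (rule cong_add[OF cong_refl])
  also have "m + 1 * (m * (v ^ r - 1)) = m * v ^ r"
    using \<open>v > 1\<close> by (simp add: diff_mult_distrib2)
  finally have dvd: "v ^ r dvd m + n * u"
    by (metis cong_dvd_iff dvd_triv_right)
  have "coprime u m"
    using u1 by (metis cong_imp_coprime cong_sym coprime_1_left)
  moreover have "coprime u (v ^ r)"
  proof (cases "r = 0")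
    case False
    show ?thesis
    proof (rule coprimeI)
      fix d assume d: "d dvd u" "d dvd v ^ r"
      then have "d dvd m"
        using dvd by (meson dvd_add_left_iff dvd_mult dvd_trans)
      moreover have "coprime (v ^ r) m"
        using v by simp
      ultimately show "is_unit d"
        using d(2) coprime_common_divisor by blast
    qed
  qed simp
  ultimately have "coprime u (v ^ r * m)"
    by simp
  then show thesis
    using that[OF \<open>v > 1\<close> v(1) u(1) _ dvd] u(2) by (simp add: M_def)
qed

lemma defect_boxI:
  assumes "(int a, int b) \<in> local_defect_set P" "1 \<le> a" "a \<le> b" "real b \<le> X"
  shows "(int a, int b) \<in> {(a, b) \<in> local_defect_set P. 1 \<le> a \<and> of_int a \<le> X \<and> 1 \<le> b \<and> of_int b \<le> X}"
  using assms by auto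

text \<open>
  For each j, the abscissas u + M i prime to j are counted in q(j) full periods of i modulo j,
  which avoids any error term. The number q(j) is limited by the size of the ordinate.
\<close>
lemma defect_count_ge_totient_sum:
  fixes m n r u v M :: nat and X :: real
  assumes "0 < m" "0 < n" "1 < v" "coprime v m" "0 < u" "u \<le> M" "M = v ^ r * m" "r > 0"
    "v ^ r dvd m + n * u" "coprime u M"
  defines "c \<equiv> (m + n * v) * M"
  assumes "X \<ge> 0" "\<And>j. j \<in> J \<Longrightarrow> j > 0 \<and> coprime j M \<and> c * j\<^sup>2 * q j \<le> X" "finite J"
  shows "(\<Sum>j\<in>J. q j * totient j) \<le> defect_count (monom 1 r * [:int m, int n:]) X"
proof -
  define I where "I = (SIGMA j:J. {i. i < q j * j \<and> coprime (u + M * i) j})"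
  define f where "f = (\<lambda>(j, i). (int ((u + M * i) * v), int (j * (m + n * ((u + M * i) * v)))))"
  have "M > 0"
    using assms by simp
  have "(\<Sum>j\<in>J. q j * totient j) = card I"
    unfolding I_def using assms(14) by (subst card_SigmaI) (auto simp: card_coprime_progression assms(13))
  also have "card I \<le> defect_count (monom 1 r * [:int m, int n:]) X"
  proof (rule card_le_defect_count)
    show "inj_on f I"
    proof (rule inj_onI, clarify)
      fix j i j' i' assume eq: "f (j, i) = f (j', i')"
      then have eqs: "(u + M * i) * v = (u + M * i') * v \<and>
          j * (m + n * ((u + M * i) * v)) = j' * (m + n * ((u + M * i') * v))"
        unfolding f_def prod.case prod.inject of_nat_eq_iff .
      then have "i = i'"
        using assms(3) \<open>M > 0\<close> by simp
      moreover have "j = j'"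
        using eqs assms(1) unfolding \<open>i = i'\<close> by simp
      ultimately show "j = j' \<and> i = i'"
        by simp
    qed
  next
    fix ji assume "ji \<in> I"
    then obtain j i where ji: "ji = (j, i)" "j \<in> J" "i < q j * j" "coprime (u + M * i) j"
      by (auto simp: I_def)
    define w where "w = u + M * i"
    have j: "j > 0" "coprime j M" "c * j\<^sup>2 * q j \<le> X"
      using assms(13)[OF ji(2)] by auto
    have "w > 0"
      using assms by (simp add: w_def)
    have cop: "coprime w M"
      using assms(10) by (metis w_def coprime_iff_gcd_eq_1 gcd.commute gcd_add_mult add.commute mult.commute)
    then have "coprime w m"
      by (simp add: assms(7))
    have "M dvd n * (M * i)"
      by simp
    then have "v ^ r dvd n * (M * i)"
      unfolding assms(7) by (meson dvd_mult_left)
    then have "v ^ r dvd m + n * w"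
      using assms(9) by (simp add: w_def distrib_left add.assoc[symmetric])
    moreover have "coprime j v"
      using j(2) assms(7,8) by simp
    moreover have "coprime j w"
      using ji(4) by (simp add: w_def coprime_commute)
    ultimately have "(int (w * v), int (j * (m + n * (w * v)))) \<in> local_defect_set (monom 1 r * [:int m, int n:])"
      using linear_family_defect[OF assms(1) \<open>w > 0\<close> assms(3) j(1) _ \<open>coprime w m\<close> assms(4)] by blast
    moreover have "1 \<le> w * v"
      using \<open>w > 0\<close> assms(3) by simp
    moreover have "w * v \<le> j * (m + n * (w * v))"
    proof -
      have "1 * (1 * (w * v)) \<le> j * (n * (w * v))"
        using j(1) assms(2) by (intro mult_le_mono) auto
      also have "\<dots> \<le> j * (m + n * (w * v))"
        by (intro mult_le_mono) auto
      finally show ?thesis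
        by simp
    qed
    moreover have "real (j * (m + n * (w * v))) \<le> X"
    proof -
      have "w \<le> M * (i + 1)"
        using assms(6) by (simp add: w_def)
      also have "\<dots> \<le> M * (q j * j)"
        using ji(3) by (intro mult_le_mono) auto
      finally have w: "w \<le> M * (q j * j)" .
      have "m + n * (w * v) \<le> (m + n * v) * w"
        using \<open>w > 0\<close> by (simp add: distrib_right)
      also have "\<dots> \<le> (m + n * v) * (M * (q j * j))"
        using w by (intro mult_le_mono) auto
      finally have "j * (m + n * (w * v)) \<le> j * ((m + n * v) * (M * (q j * j)))"
        by (intro mult_le_mono) auto
      also have "\<dots> = c * j\<^sup>2 * q j"
        by (simp add: c_def power2_eq_square)
      finally show ?thesis
        using j(3) by (meson of_nat_le_iff order_trans)
    qed
    ultimately show "f ji \<in> {(a, b) \<in> local_defect_set (monom 1 r * [:int m, int n:]).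
        1 \<le> a \<and> of_int a \<le> X \<and> 1 \<le> b \<and> of_int b \<le> X}"
      unfolding ji(1) f_def prod.case w_def[symmetric] by (rule defect_boxI)
  qed
  finally show ?thesis .
qed

lemma nat_floor_bounds:
  fixes x :: real
  assumes "x \<ge> 1"
  shows "nat \<lfloor>x\<rfloor> \<ge> 1" "real (nat \<lfloor>x\<rfloor>) \<le> x" "real (nat \<lfloor>x\<rfloor>) \<ge> x / 2"
proof -
  have "\<lfloor>x\<rfloor> \<ge> 1"
    using assms by simp
  then have "real (nat \<lfloor>x\<rfloor>) = real_of_int \<lfloor>x\<rfloor>" "nat \<lfloor>x\<rfloor> \<ge> 1"
    by (auto simp: le_nat_iff)
  then show "nat \<lfloor>x\<rfloor> \<ge> 1" "real (nat \<lfloor>x\<rfloor>) \<le> x" "real (nat \<lfloor>x\<rfloor>) \<ge> x / 2"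
    using assms by linarith+
qed

text \<open>
  With Z = X / c, the j up to sqrt Z contribute about Z totient(j) / j^2 points each, and the sum of
  totient(j) / j^2 grows like a logarithm.
\<close>
lemma defect_count_lower_bound:
  fixes m n r :: nat
  assumes "0 < m" "0 < n" "0 < r"
  shows "(\<lambda>X. real (defect_count (monom 1 r * [:int m, int n:]) X)) \<in> \<Omega>(\<lambda>X. X * ln X)"
proof -
  obtain v u where vu: "1 < v" "coprime v m" "0 < u" "u \<le> v ^ r * m" "v ^ r dvd m + n * u"
    "coprime u (v ^ r * m)"
    using ex_progression[OF assms(1,2)] by metis
  define M where "M = v ^ r * m"
  define c where "c = (m + n * v) * M"
  have "M \<ge> 1"
    using vu assms by (simp add: M_def)
  then have "c \<ge> 1"
    using assms by (simp add: c_def)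
  \<comment> \<open>For X \<ge> K^2 the range of j satisfies N / M \<ge> X^(1/4), so its logarithm is comparable to that of X.\<close>
  define K where "K = real c * (2 * real M) ^ 2"
  have "real c \<ge> 1"
    using \<open>c \<ge> 1\<close> by simp
  have "(2 * real M) ^ 2 \<ge> 1"
    using \<open>M \<ge> 1\<close> by (intro one_le_power) simp
  then have "1 * 1 \<le> real c * (2 * real M) ^ 2"
    using \<open>real c \<ge> 1\<close> by (intro mult_mono) auto
  then have "K \<ge> 1"
    by (simp add: K_def)
  show ?thesis
  proof (rule landau_omega.bigI)
    show "1 / (16 * real c * real M) > 0"
      using \<open>M \<ge> 1\<close> \<open>c \<ge> 1\<close> by simp
    show "\<forall>\<^sub>F X in at_top. norm (real (defect_count (monom 1 r * [:int m, int n:]) X))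
        \<ge> 1 / (16 * real c * real M) * norm (X * ln X)"
      using eventually_ge_at_top[of "K\<^sup>2"]
    proof eventually_elim
      case (elim X)
      have "K * 1 \<le> K\<^sup>2"
        unfolding power2_eq_square using \<open>K \<ge> 1\<close> by (intro mult_left_mono) auto
      then have "X \<ge> K" "X \<ge> 1"
        using elim \<open>K \<ge> 1\<close> by auto
      have "K \<ge> real c"
        unfolding K_def using mult_left_mono[OF \<open>(2 * real M) ^ 2 \<ge> 1\<close>, of "real c"] by simp
      define Z where "Z = X / real c"
      have "Z \<ge> 1"
        using \<open>X \<ge> K\<close> \<open>K \<ge> real c\<close> \<open>c \<ge> 1\<close> by (simp add: Z_def field_simps)
      define N where "N = nat \<lfloor>sqrt Z\<rfloor>"
      have "sqrt Z \<ge> 1"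
        using \<open>Z \<ge> 1\<close> by simp
      then have N: "N \<ge> 1" "real N \<le> sqrt Z" "real N \<ge> sqrt Z / 2"
        unfolding N_def by (rule nat_floor_bounds)+
      define J where "J = {j. j \<in> {1..N} \<and> coprime j M}"
      define q where "q j = nat \<lfloor>Z / real j ^ 2\<rfloor>" for j :: nat
      have q: "real (q j) \<le> Z / real j ^ 2" "real (q j) \<ge> Z / (2 * real j ^ 2)" if "j \<in> J" for j
      proof -
        have "real j \<le> sqrt Z" "j > 0"
          using that N(2) by (auto simp: J_def intro: order_trans[of _ "real N"])
        then have "real j ^ 2 \<le> Z"
          using \<open>Z \<ge> 1\<close> by (metis of_nat_0_le_iff power_mono real_sqrt_pow2 order_trans zero_le_one)
        then have "Z / real j ^ 2 \<ge> 1"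
          using \<open>j > 0\<close> by (simp add: field_simps)
        note nat_floor_bounds[OF this]
        then show "real (q j) \<le> Z / real j ^ 2" "real (q j) \<ge> Z / (2 * real j ^ 2)"
          by (auto simp: q_def)
      qed
      have sum: "(\<Sum>j\<in>J. q j * totient j) \<le> defect_count (monom 1 r * [:int m, int n:]) X"
      proof (rule defect_count_ge_totient_sum[OF assms(1,2) vu(1-3) _ M_def assms(3) vu(5)])
        show "u \<le> M" "coprime u M" "finite J" "X \<ge> 0"
          using vu \<open>X \<ge> 1\<close> by (auto simp: M_def J_def)
        fix j assume "j \<in> J"
        have "real c * real j ^ 2 * real (q j) \<le> real c * real j ^ 2 * (Z / real j ^ 2)"
          using q(1)[OF \<open>j \<in> J\<close>] by (intro mult_left_mono) auto
        also have "\<dots> = X"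
          using \<open>j \<in> J\<close> \<open>c \<ge> 1\<close> by (simp add: Z_def J_def)
        finally have "real c * real j ^ 2 * real (q j) \<le> X" .
        then show "j > 0 \<and> coprime j M \<and> real ((m + n * v) * M) * real j ^ 2 * real (q j) \<le> X"
          using \<open>j \<in> J\<close> unfolding c_def J_def by auto
      qed
      have "ln (real N / real M) \<ge> ln X / 4"
      proof -
        have "sqrt X \<ge> K"
          using elim \<open>K \<ge> 1\<close> by (simp add: real_le_rsqrt)
        have "sqrt X * K \<le> sqrt X * sqrt X"
          using \<open>sqrt X \<ge> K\<close> \<open>X \<ge> 1\<close> by (intro mult_left_mono) auto
        then have "sqrt X \<le> X / K"
          using \<open>X \<ge> 1\<close> \<open>K \<ge> 1\<close> by (simp add: field_simps)
        then have "sqrt (sqrt X) \<le> sqrt (X / K)"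
          by simp
        also have "\<dots> = sqrt Z / (2 * real M)"
          by (simp add: K_def Z_def real_sqrt_divide real_sqrt_mult)
        also have "\<dots> = (sqrt Z / 2) / real M"
          by simp
        also have "\<dots> \<le> real N / real M"
          using N(3) by (rule divide_right_mono) simp
        finally have "ln (sqrt (sqrt X)) \<le> ln (real N / real M)"
          using \<open>X \<ge> 1\<close> by (intro ln_mono) auto
        then show ?thesis
          using \<open>X \<ge> 1\<close> by (simp add: ln_sqrt)
      qed
      then have "ln X / 4 / (2 * real M) \<le> ln (real N / real M) / (2 * real M)"
        by (rule divide_right_mono) simp
      also have "\<dots> \<le> (\<Sum>j\<in>J. real (totient j) / real j ^ 2)"
        unfolding J_def by (rule sum_totient_div_square_ge[OF \<open>M \<ge> 1\<close> N(1)])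
      finally have "Z / 2 * (ln X / 4 / (2 * real M)) \<le> Z / 2 * (\<Sum>j\<in>J. real (totient j) / real j ^ 2)"
        using \<open>Z \<ge> 1\<close> by (intro mult_left_mono) auto
      also have "\<dots> = (\<Sum>j\<in>J. Z / (2 * real j ^ 2) * real (totient j))"
        by (simp add: sum_distrib_left)
      also have "\<dots> \<le> (\<Sum>j\<in>J. real (q j) * real (totient j))"
        by (intro sum_mono mult_right_mono q) auto
      also have "\<dots> = real (\<Sum>j\<in>J. q j * totient j)"
        by simp
      also have "\<dots> \<le> real (defect_count (monom 1 r * [:int m, int n:]) X)"
        using sum by (simp only: of_nat_le_iff)
      finally have "1 / (16 * real c * real M) * (X * ln X) \<le> real (defect_count (monom 1 r * [:int m, int n:]) X)"
        by (simp add: Z_def mult_ac)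
      then show ?case
        using \<open>X \<ge> 1\<close> by simp
    qed
  qed
qed

section \<open>The divisor bound\<close>

lemma card_divisors_prime_power_mult_le:
  fixes p k m :: nat
  assumes "prime p" "m > 0"
  shows "card {e. e dvd p ^ k * m} \<le> (k + 1) * card {e. e dvd m}"
proof -
  have fin: "finite {e. e dvd m}"
    using assms by (simp add: finite_divisors_nat)
  have "{e. e dvd p ^ k * m} \<subseteq> (\<lambda>(i, e). p ^ i * e) ` ({..k} \<times> {e. e dvd m})"
  proof
    fix e assume "e \<in> {e. e dvd p ^ k * m}"
    then obtain c d where cd: "e = c * d" "c dvd p ^ k" "d dvd m"
      using division_decomp by blast
    then obtain i where "i \<le> k" "c = p ^ i"
      using divides_primepow_nat[OF assms(1)] by blast
    with cd show "e \<in> (\<lambda>(i, e). p ^ i * e) ` ({..k} \<times> {e. e dvd m})"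
      by force
  qed
  then have "card {e. e dvd p ^ k * m} \<le> card ({..k} \<times> {e. e dvd m})"
    using fin by (meson card_image_le card_mono finite_SigmaI finite_atMost finite_imageI le_trans)
  then show ?thesis
    by (simp add: card_cartesian_product)
qed

text \<open>
  The number B bounds what a small prime contributes to the divisor bound, whatever its
  multiplicity k.
\<close>
lemma linear_le_exponential:
  fixes \<epsilon> :: real
  assumes "\<epsilon> > 0"
  obtains B where "B \<ge> 1" "\<And>k::nat. real k + 1 \<le> B * 2 powr (\<epsilon> * real k)"
proof
  define B where "B = max 1 (1 / (\<epsilon> * ln 2))"
  show "B \<ge> 1"
    by (simp add: B_def)
  show "real k + 1 \<le> B * 2 powr (\<epsilon> * real k)" for k
  proof -
    have "1 \<le> B * (\<epsilon> * ln 2)"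
      using assms by (simp add: B_def max_def field_simps)
    then have "real k * 1 \<le> real k * (B * (\<epsilon> * ln 2))"
      by (intro mult_left_mono) auto
    then have "real k + 1 \<le> B * (\<epsilon> * ln 2 * real k) + B"
      using \<open>B \<ge> 1\<close> by (simp add: mult_ac)
    also have "\<dots> = B * (1 + \<epsilon> * real k * ln 2)"
      by (simp add: algebra_simps)
    also have "\<dots> \<le> B * exp (\<epsilon> * real k * ln 2)"
      using \<open>B \<ge> 1\<close> by (intro mult_left_mono exp_ge_add_one_self) auto
    finally show ?thesis
      by (simp add: powr_def)
  qed
qed

text \<open>
  The quotient of the divisor function by n^\<epsilon> is multiplicative, and at p^k it is
  (k + 1) / p^(\<epsilon> k). If p is at least L, where L is about 2^(1/\<epsilon>), then this is at most
  (k + 1) / 2^k and so at most 1. Each of the fewer than L smaller primes contributes at most a factor B.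
\<close>
lemma divisor_bound:
  fixes \<epsilon> :: real
  assumes "\<epsilon> > 0"
  obtains C where "C \<ge> 1" "\<And>n::nat. n > 0 \<Longrightarrow> real (card {d. d dvd n}) \<le> C * real n powr \<epsilon>"
proof -
  obtain B where B: "B \<ge> 1" "\<And>k::nat. real k + 1 \<le> B * 2 powr (\<epsilon> * real k)"
    using linear_le_exponential[OF assms] by blast
  define L where "L = nat \<lceil>2 powr (1 / \<epsilon>)\<rceil>"
  have main: "real (card {d. d dvd n}) \<le> B ^ card {p. prime p \<and> p < L \<and> p dvd n} * real n powr \<epsilon>"
    if "n > 0" for n :: nat
    using that
  proof (induction n rule: less_induct)
    case (less n)
    show ?case
    proof (cases "n = 1")
      case True
      then show ?thesis
        using B by simp
    next
      case False
      then obtain p where p: "prime p" "p dvd n"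
        using prime_factor_nat by blast
      obtain m where m: "n = p ^ multiplicity p n * m" "\<not> p dvd m"
        using multiplicity_decompose'[of n p] p less.prems by (metis gr0_implies_Suc nat.distinct(1) not_prime_unit)
      define k where "k = multiplicity p n"
      have n: "n = p ^ k * m"
        using m by (simp add: k_def)
      have "k > 0"
        using p less.prems by (simp add: k_def prime_multiplicity_gt_zero_iff)
      have "m > 0"
        using less.prems n by (cases m) auto
      have "p ^ k > 1"
        using p \<open>k > 0\<close> by (intro one_less_power prime_gt_1_nat)
      then have "m < n"
        using \<open>m > 0\<close> by (simp add: n)
      define S where "S j = {q. prime q \<and> q < L \<and> q dvd (j::nat)}" for j
      have finS: "finite (S j)" for j
        by (rule finite_subset[of _ "{..<L}"]) (auto simp: S_def)
      have "S m \<subseteq> S n"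
        by (auto simp: S_def n)
      have IH: "real (card {d. d dvd m}) \<le> B ^ card (S m) * real m powr \<epsilon>"
        using less.IH[OF \<open>m < n\<close> \<open>m > 0\<close>] by (simp add: S_def)
      \<comment> \<open>S counts the small primes, so a small p is paid for by one further factor B.\<close>
      have step: "(real k + 1) * B ^ card (S m) \<le> B ^ card (S n) * real p powr (\<epsilon> * real k)"
      proof (cases "p < L")
        case True
        have "p \<in> S n" "p \<notin> S m"
          using True p m by (auto simp: S_def)
        with \<open>S m \<subseteq> S n\<close> have "insert p (S m) \<subseteq> S n"
          by blast
        then have "card (insert p (S m)) \<le> card (S n)"
          using finS card_mono by blast
        then have card: "Suc (card (S m)) \<le> card (S n)"
          using \<open>p \<notin> S m\<close> finS by simp
        have "(real k + 1) * B ^ card (S m) \<le> (B * 2 powr (\<epsilon> * real k)) * B ^ card (S m)"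
          using B by (intro mult_right_mono) auto
        also have "\<dots> = B ^ Suc (card (S m)) * 2 powr (\<epsilon> * real k)"
          by simp
        also have "\<dots> \<le> B ^ card (S n) * real p powr (\<epsilon> * real k)"
          using B card p assms prime_ge_2_nat[OF p(1)]
          by (intro mult_mono power_increasing powr_mono2) auto
        finally show ?thesis .
      next
        case False
        then have "2 powr (1 / \<epsilon>) \<le> real p"
          by (simp add: L_def) linarith
        then have "(2 powr (1 / \<epsilon>)) powr (\<epsilon> * real k) \<le> real p powr (\<epsilon> * real k)"
          using assms by (intro powr_mono2) auto
        then have "2 ^ k \<le> real p powr (\<epsilon> * real k)"
          using assms by (simp add: powr_powr powr_realpow)
        moreover have "real k + 1 \<le> 2 ^ k"
        proof -
          have "k + 1 \<le> 2 ^ k"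
            using less_exp[of k] by linarith
          then have "real (k + 1) \<le> real (2 ^ k)"
            by (simp only: of_nat_le_iff)
          then show ?thesis
            by simp
        qed
        ultimately have "real k + 1 \<le> real p powr (\<epsilon> * real k)"
          by simp
        moreover have "B ^ card (S m) \<le> B ^ card (S n)"
          using B \<open>S m \<subseteq> S n\<close> finS by (intro power_increasing card_mono) auto
        ultimately show ?thesis
          using B by (subst mult.commute) (intro mult_mono, auto)
      qed
      have "real (card {d. d dvd n}) \<le> real ((k + 1) * card {d. d dvd m})"
        using card_divisors_prime_power_mult_le[OF p(1) \<open>m > 0\<close>, of k] by (simp only: n of_nat_le_iff)
      also have "\<dots> = (real k + 1) * real (card {d. d dvd m})"
        by (simp add: distrib_right)
      also have "\<dots> \<le> (real k + 1) * (B ^ card (S m) * real m powr \<epsilon>)"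
        using IH by (intro mult_left_mono) auto
      also have "\<dots> = ((real k + 1) * B ^ card (S m)) * real m powr \<epsilon>"
        by simp
      also have "\<dots> \<le> (B ^ card (S n) * real p powr (\<epsilon> * real k)) * real m powr \<epsilon>"
        using step by (intro mult_right_mono) auto
      also have "\<dots> = B ^ card (S n) * real n powr \<epsilon>"
        using prime_gt_0_nat[OF p(1)] \<open>m > 0\<close>
        by (simp add: n powr_mult powr_powr mult_ac flip: powr_realpow)
      finally show ?thesis
        by (simp add: S_def)
    qed
  qed
  show thesis
  proof (rule that)
    show "B ^ L \<ge> 1"
      using B by simp
    show "real (card {d. d dvd n}) \<le> B ^ L * real n powr \<epsilon>" if "n > 0" for n
    proof -
      have "card {p. prime p \<and> p < L \<and> p dvd n} \<le> card {..<L}"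
        by (rule card_mono) auto
      then have "B ^ card {p. prime p \<and> p < L \<and> p dvd n} \<le> B ^ L"
        using B by (intro power_increasing) auto
      then have "B ^ card {p. prime p \<and> p < L \<and> p dvd n} * real n powr \<epsilon> \<le> B ^ L * real n powr \<epsilon>"
        by (intro mult_right_mono) auto
      then show ?thesis
        using main[OF that] by linarith
    qed
  qed
qed

section \<open>Arithmetic of defect points of T^r (m + n T)\<close>

text \<open>
  With g = gcd(a, b) the hypotheses give g | u, and the relation may be divided by g. Then it relates
  the cofactor b / g, which is prime to a / g and hence to v. As v is also prime to t, its power v^r
  can only divide the linear factor m + n s. Here u, v, t are gcd(a, s), a / u, s / u.
\<close>
lemma defect_parametrisation:
  fixes a b s c m n r :: nat
  assumes "0 < s" "s < a" "b * (s ^ r * (m + n * s)) = c * (a ^ r * (m + n * a))"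
    and "gcd a b dvd s" "gcd a b dvd c"
  obtains u v t where "a = u * v" "0 < u" "0 < t" "t < v" "v ^ r dvd m + n * (u * t)"
    "m + n * a dvd b * (t ^ r * (m + n * (u * t)))"
proof -
  define u where "u = gcd a s"
  define g where "g = gcd a b"
  have "u > 0" "g > 0"
    using assms by (auto simp: u_def g_def)
  obtain v t where vt: "a = u * v" "s = u * t" "coprime v t"
    unfolding u_def by (metis assms(1) gcd_coprime_exists gr_implies_not0 gcd_eq_0_iff mult.commute)
  have "g dvd u"
    using assms(4) by (simp add: g_def u_def)
  then obtain u' where u': "u = g * u'"
    by blast
  obtain a' b' where ab: "a = a' * g" "b = b' * g" "coprime a' b'"
    unfolding g_def by (metis assms(1,2) gcd_coprime_exists gcd_eq_0_iff not_less_zero)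
  have "a' = u' * v"
    using ab(1) vt(1) u' \<open>g > 0\<close> by (simp add: mult_ac)
  then have "coprime v b'"
    using ab(3) by simp
  obtain c' where c': "c = g * c'"
    using assms(5) by (auto simp: g_def)
  have "g * u ^ r * (b' * (t ^ r * (m + n * s))) = g * u ^ r * (c' * (v ^ r * (m + n * a)))"
    using assms(3) unfolding ab(2) c' by (simp add: vt(1,2) power_mult_distrib mult_ac)
  then have eq: "b' * (t ^ r * (m + n * s)) = c' * (v ^ r * (m + n * a))"
    using \<open>g > 0\<close> \<open>u > 0\<close> by simp
  then have "v ^ r dvd (b' * t ^ r) * (m + n * s)"
    by (metis dvd_triv_left mult.assoc mult.left_commute)
  moreover have "coprime (v ^ r) (b' * t ^ r)"
    using \<open>coprime v b'\<close> vt(3) by simp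
  ultimately have "v ^ r dvd m + n * (u * t)"
    by (simp add: coprime_dvd_mult_right_iff vt)
  moreover have "m + n * a dvd b * (t ^ r * (m + n * (u * t)))"
    using eq unfolding ab(2) vt(2) by (metis dvd_triv_right dvd_mult mult.assoc mult.commute)
  moreover have "0 < t" "t < v"
    using assms(1,2) vt by auto
  ultimately show thesis
    using that vt(1) \<open>u > 0\<close> by blast
qed

text \<open>
  Split the common divisor as e1 e2 with e1 | t^r and e2 | m + n u t. Then e2 divides the difference
  n u (v - t) of the linear values. It is prime to n, and its common factor with u divides m, so e2
  divides m (v - t).
\<close>
lemma gcd_linear_values_le:
  fixes m n u v t r :: nat
  assumes "coprime m n" "0 < m" "0 < t" "t < v"
  shows "gcd (m + n * (u * v)) (t ^ r * (m + n * (u * t))) \<le> m * v ^ (r + 1)"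
proof -
  let ?K = "m + n * (u * v)" and ?L = "m + n * (u * t)"
  obtain e1 e2 where e: "gcd ?K (t ^ r * ?L) = e1 * e2" "e1 dvd t ^ r" "e2 dvd ?L"
    using division_decomp[of "gcd ?K (t ^ r * ?L)" "t ^ r" ?L] by auto
  have "e2 dvd ?K"
    by (metis dvd_mult_left dvd_triv_right e(1) gcd_dvd1 mult.commute)
  have "e2 dvd ?K - ?L"
    using \<open>e2 dvd ?K\<close> e(3) by (rule dvd_diff_nat)
  also have "?K - ?L = n * (u * (v - t))"
    by (simp add: diff_mult_distrib2)
  finally have "e2 dvd n * (u * (v - t))" .
  moreover have "coprime e2 n"
  proof (rule coprimeI)
    fix d assume d: "d dvd e2" "d dvd n"
    then have "d dvd ?K"
      using \<open>e2 dvd ?K\<close> dvd_trans by blast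
    then have "d dvd m"
      using d(2) by (metis dvd_add_left_iff dvd_mult2)
    with d(2) assms(1) show "is_unit d"
      using coprime_common_divisor by blast
  qed
  ultimately have "e2 dvd u * (v - t)"
    by (simp add: coprime_dvd_mult_right_iff)
  then have "e2 dvd gcd e2 u * (v - t)"
    by (metis dvd_triv_left gcd_greatest gcd_mult_distrib_nat mult.commute)
  moreover have "gcd e2 u dvd m"
  proof -
    have "gcd e2 u dvd ?K"
      using \<open>e2 dvd ?K\<close> by (meson dvd_trans gcd_dvd1)
    moreover have "gcd e2 u dvd n * (u * v)"
      by simp
    ultimately show ?thesis
      by (metis dvd_add_left_iff)
  qed
  ultimately have "e2 dvd m * (v - t)"
    by (meson dvd_trans mult_dvd_mono dvd_refl)
  then have "e2 \<le> m * (v - t)"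
    using assms by (intro dvd_imp_le) auto
  also have "\<dots> \<le> m * v"
    by simp
  finally have "e2 \<le> m * v" .
  moreover have "e1 \<le> v ^ r"
  proof -
    have "e1 \<le> t ^ r"
      using e(2) assms by (intro dvd_imp_le) auto
    also have "\<dots> \<le> v ^ r"
      using assms by (intro power_mono) auto
    finally show ?thesis .
  qed
  ultimately have "e1 * e2 \<le> v ^ r * (m * v)"
    by (intro mult_mono) auto
  then show ?thesis
    unfolding e(1) by (simp add: mult_ac)
qed

text \<open>
  K divides b x exactly for the b divisible by K / gcd(K, x). The count is compared
  with N times the density and there is no rounding error, since rounding down only helps.
\<close>
lemma card_multiples_le:
  fixes K x N :: nat
  assumes "K > 0"
  shows "real (card {b \<in> {1..N}. K dvd b * x}) \<le> real N * (real (gcd K x) / real K)"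
proof -
  define d where "d = K div gcd K x"
  have K: "K = d * gcd K x"
    by (simp add: d_def)
  have "d > 0"
    using assms K by (metis gr0I mult_is_0)
  have "d dvd b" if "K dvd b * x" for b
  proof -
    have "K dvd b * gcd K x"
      using that by (metis dvd_triv_right gcd_greatest gcd_mult_distrib_nat)
    then have "d * gcd K x dvd b * gcd K x"
      using K by simp
    then show ?thesis
      using assms by (simp add: gcd_eq_0_iff)
  qed
  then have "{b \<in> {1..N}. K dvd b * x} \<subseteq> (\<lambda>i. d * i) ` {1..N div d}"
    using \<open>d > 0\<close> by (force simp: div_le_mono less_eq_div_iff_mult_less_eq mult.commute elim!: dvdE)
  then have "card {b \<in> {1..N}. K dvd b * x} \<le> card {1..N div d}"
    by (meson card_image_le card_mono finite_atLeastAtMost finite_imageI le_trans)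
  then have "real (card {b \<in> {1..N}. K dvd b * x}) \<le> real (N div d)"
    by simp
  also have "\<dots> \<le> real N / real d"
    by (rule of_nat_div_le_of_nat)
  also have "\<dots> = real N * (real (gcd K x) / real K)"
  proof -
    have "real K = real d * real (gcd K x)"
      using K by (metis of_nat_mult)
    moreover have "gcd K x > 0"
      using assms by simp
    ultimately show ?thesis
      using \<open>d > 0\<close> by simp
  qed
  finally show ?thesis .
qed

text \<open>
  The ratio is at most 1 and at most m v^(r+1) / (v^r z) = m v / z. Hence it is at most
  (m v / z)^(1/3) \<le> m (v / z)^(1/3), and (v / z)^(1/3) = (v^2 z)^(2/3) / (v z), where v^2 z \<le> Y. The
  exponent 1/3 is chosen to make the bound summable over v and z with only logarithmic loss.
\<close>
lemma gcd_ratio_le: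
  fixes e K m v z Y :: real and r :: nat
  assumes "0 < e" "e \<le> K" "e \<le> m * v ^ (r + 1)" "v ^ r * z \<le> K" "v ^ r * z \<le> Y"
    and "m \<ge> 1" "v \<ge> 1" "z \<ge> 1" "r \<ge> 2"
  shows "e / K \<le> m * Y powr (2/3) * (1 / (v * z))"
proof -
  have "v ^ r * z > 0"
    using assms by simp
  have "e / K \<le> (e / K) powr (1/3)"
  proof -
    have "(e / K) powr 1 \<le> (e / K) powr (1/3)"
      using assms by (intro powr_mono') auto
    then show ?thesis
      using assms by simp
  qed
  also have "\<dots> \<le> (m * v / z) powr (1/3)"
  proof (rule powr_mono2)
    have "e / K \<le> (m * v ^ (r + 1)) / (v ^ r * z)"
      using assms \<open>v ^ r * z > 0\<close> by (intro frac_le) auto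
    also have "\<dots> = m * v / z"
      using assms by simp
    finally show "e / K \<le> m * v / z" .
  qed (use assms in auto)
  also have "\<dots> \<le> (m ^ 3 * (v / z)) powr (1/3)"
  proof (rule powr_mono2)
    have "m \<le> m ^ 3"
      using assms by (intro self_le_power) auto
    then have "m * (v / z) \<le> m ^ 3 * (v / z)"
      using assms by (intro mult_right_mono) auto
    then show "m * v / z \<le> m ^ 3 * (v / z)"
      by simp
  qed (use assms in auto)
  also have "\<dots> = m * (v / z) powr (1/3)"
  proof -
    have "(m ^ 3 * (v / z)) powr (1/3) = (m ^ 3) powr (1/3) * (v / z) powr (1/3)"
      by (rule powr_mult)
    also have "(m ^ 3) powr (1/3) = m"
      using assms by (simp add: powr_powr flip: powr_numeral)
    finally show ?thesis .
  qed
  also have "(v / z) powr (1/3) = (v\<^sup>2 * z) powr (2/3) * (1 / (v * z))"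
  proof -
    have "(v\<^sup>2 * z) powr (2/3) = v powr (4/3) * z powr (2/3)"
      using assms by (simp add: powr_mult powr_powr flip: powr_numeral)
    also have "v powr (4/3) = v * v powr (1/3)"
      using assms powr_add[of v 1 "1/3"] by simp
    also have "z powr (2/3) = z / z powr (1/3)"
      using assms powr_diff[of z 1 "1/3"] by simp
    finally show ?thesis
      using assms by (simp add: powr_divide)
  qed
  also have "(v\<^sup>2 * z) powr (2/3) \<le> Y powr (2/3)"
  proof (rule powr_mono2)
    have "v ^ 2 \<le> v ^ r"
      using assms by (intro power_increasing) auto
    then have "v\<^sup>2 * z \<le> v ^ r * z"
      using assms by (intro mult_right_mono) auto
    then show "v\<^sup>2 * z \<le> Y"
      using assms by linarith
  qed (use assms in auto)
  finally show ?thesis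
    using assms by (simp add: mult_left_mono mult_right_mono divide_right_mono)
qed

lemma harm_le_powr:
  fixes \<delta> :: real
  assumes "\<delta> > 0" "n \<ge> 1"
  shows "harm n \<le> (1 + 1 / \<delta>) * real n powr \<delta>"
proof -
  obtain k where n: "n = Suc k"
    using assms by (cases n) auto
  have "harm (Suc k) - ln (Suc k) \<le> harm (Suc 0) - ln (real (Suc 0))"
    using decseq_harm_diff_ln unfolding decseq_def by blast
  then have "harm n \<le> 1 + ln (real n)"
    by (simp add: n harm_def)
  also have "\<dots> \<le> real n powr \<delta> + real n powr \<delta> / \<delta>"
    using assms by (intro add_mono ln_powr_bound ge_one_powr_ge_zero) auto
  finally show ?thesis
    by (simp add: algebra_simps)
qed

section \<open>Counting defect points from above\<close>

text \<open>
  The ordinates available over one choice of (v, z, t): they have to be divisible by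
  K / gcd(K, t^r v^r z), and that gcd is controlled both by K and by m v^(r+1).
\<close>
lemma defect_count_fibre_bound:
  fixes m n r v w z t N :: nat
  assumes "coprime m n" "1 \<le> m" "1 \<le> n" "2 \<le> r" "0 < t" "t < v" "t dvd w" "1 \<le> z"
    and y: "m + n * w = v ^ r * z" and "v ^ r * z \<le> Y"
  defines "K \<equiv> m + n * (w div t * v)"
  shows "real (card {b \<in> {1..N}. K dvd b * (t ^ r * (v ^ r * z))})
    \<le> real N * (real m * real Y powr (2/3) * (1 / (real v * real z)))"
proof -
  let ?u = "w div t"
  let ?e = "gcd K (t ^ r * (v ^ r * z))"
  have w: "w = ?u * t"
    using assms(7) by simp
  have L: "m + n * (?u * t) = v ^ r * z"
    using assms(7) y by simp
  have "K > 0"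
    unfolding K_def using assms(2) by simp
  have "?e \<le> m * v ^ (r + 1)"
    unfolding K_def L[symmetric] using assms(2) by (intro gcd_linear_values_le[OF assms(1) _ assms(5,6)]) simp
  then have "real ?e \<le> real (m * v ^ (r + 1))"
    by (simp only: of_nat_le_iff)
  then have 1: "real ?e \<le> real m * real v ^ (r + 1)"
    by simp
  have "w \<le> ?u * v"
    using w assms(6) by (metis less_imp_le mult_le_mono2)
  then have "v ^ r * z \<le> K"
    unfolding y[symmetric] K_def by simp
  then have "real (v ^ r * z) \<le> real K"
    by (simp only: of_nat_le_iff)
  then have 2: "real v ^ r * real z \<le> real K"
    by simp
  have "real (v ^ r * z) \<le> real Y"
    using assms(10) by (simp only: of_nat_le_iff)
  then have 3: "real v ^ r * real z \<le> real Y"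
    by simp
  have 4: "real ?e \<le> real K" "0 < real ?e"
    using \<open>K > 0\<close> by (auto intro: gcd_le1_nat)
  have "real ?e / real K \<le> real m * real Y powr (2/3) * (1 / (real v * real z))"
    by (rule gcd_ratio_le[OF 4(2,1) 1 2 3]) (use assms in auto)
  moreover have "real (card {b \<in> {1..N}. K dvd b * (t ^ r * (v ^ r * z))}) \<le> real N * (real ?e / real K)"
    by (rule card_multiples_le[OF \<open>K > 0\<close>])
  ultimately show ?thesis
    by (meson mult_left_mono of_nat_0_le_iff order_trans)
qed

text \<open>
  Every defect point in the box is reached from a triple (v, z, t), where v^r z = m + n w and t is a
  divisor of w; here w = u t is the earlier abscissa s.
\<close>
lemma defect_point_cover:
  fixes m n r N :: nat and a b :: int
  assumes "1 \<le> m" "1 \<le> n" "(a, b) \<in> local_defect_set (monom 1 r * [:int m, int n:])"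
    and "1 \<le> a" "a \<le> int N" "1 \<le> b" "b \<le> int N"
  obtains v z w t b' where "1 \<le> z" "0 < w" "0 < t" "t < v" "t dvd w"
    "m + n * w = v ^ r * z" "v ^ r * z \<le> m + n * N"
    "a = int (w div t * v)" "b = int b'" "b' \<in> {1..N}" 
    "m + n * (w div t * v) dvd b' * (t ^ r * (v ^ r * z))"
proof -
  let ?P = "monom 1 r * [:int m, int n:]"
  have pos: "poly ?P x > 0" if "0 < x" for x
    unfolding poly_monom_linear using that assms(1,2)
    by (intro mult_pos_pos zero_less_power add_pos_nonneg) auto
  obtain s c where s: "0 < s" "s < a" "b * poly ?P s = c * poly ?P a" "gcd a b dvd s" "gcd a b dvd c"
    using defect_pointE[OF assms(3) _ pos] assms(6) by auto
  have "0 < b * poly ?P s"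
    by (intro mult_pos_pos pos) (use s assms(6) in auto)
  moreover have "poly ?P a > 0"
    by (rule pos) (use assms(4) in simp)
  ultimately have "c > 0"
    unfolding s(3) by (rule zero_less_mult_pos2)
  define a' b' s' c' where "a' = nat a" "b' = nat b" "s' = nat s" "c' = nat c"
  have int: "a = int a'" "b = int b'" "s = int s'" "c = int c'"
    using assms s \<open>c > 0\<close> by (auto simp: a'_b'_s'_c'_def)
  have "int (b' * (s' ^ r * (m + n * s'))) = int (c' * (a' ^ r * (m + n * a')))"
    using s(3) unfolding poly_monom_linear int by simp
  then have "b' * (s' ^ r * (m + n * s')) = c' * (a' ^ r * (m + n * a'))"
    by (simp only: of_nat_eq_iff)
  moreover have "gcd a' b' dvd s'" "gcd a' b' dvd c'"
    using s(4,5) unfolding int by auto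
  ultimately obtain u v t where uvt: "a' = u * v" "0 < u" "0 < t" "t < v"
    "v ^ r dvd m + n * (u * t)" "m + n * a' dvd b' * (t ^ r * (m + n * (u * t)))"
    using defect_parametrisation[of s' a' b' r m n c'] s(1,2) unfolding int by auto
  then obtain z where z: "m + n * (u * t) = v ^ r * z"
    by blast
  show thesis
  proof (rule that[of z "u * t" t v b'])
    show "1 \<le> z"
      using z assms(1) by (cases z) auto
    have "u * t \<le> u * v"
      using uvt(4) by simp
    also have "\<dots> \<le> N"
      using assms(5) unfolding int uvt(1) by (simp only: of_nat_le_iff)
    finally have "n * (u * t) \<le> n * N"
      by simp
    then show "v ^ r * z \<le> m + n * N"
      by (simp add: z[symmetric])
    show "a = int (u * t div t * v)" 
      using uvt by (simp add: int)
    show "m + n * (u * t div t * v) dvd b' * (t ^ r * (v ^ r * z))"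
      using uvt by (simp add: z[symmetric])
  qed (use uvt z int assms in auto)
qed

text \<open>
  Summing the fibre bound over the triples (v, z, t): the divisors t of w cost a factor Y^\<delta>, and the
  weights 1 / (v z) add up to at most the square of a harmonic number.
\<close>
lemma defect_count_le:
  fixes m n r N Y :: nat and X \<delta> C :: real
  assumes "coprime m n" "1 \<le> m" "1 \<le> n" "2 \<le> r"
    and div: "\<And>k::nat. k > 0 \<Longrightarrow> real (card {d. d dvd k}) \<le> C * real k powr \<delta>"
    and "C \<ge> 0" "\<delta> > 0"
  defines "N \<equiv> nat \<lfloor>X\<rfloor>" and "Y \<equiv> m + n * nat \<lfloor>X\<rfloor>"
  shows "real (defect_count (monom 1 r * [:int m, int n:]) X)
    \<le> (C * real Y powr \<delta>) * (real N * (real m * real Y powr (2/3))) * (harm Y)\<^sup>2"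
proof -
  \<comment> \<open>A pair (v, z) determines w, then t ranges over divisors of w, and S lists the points over (v, z, t).\<close>
  define I where "I = {(v, z). v \<in> {1..Y} \<and> z \<in> {1..Y} \<and> v ^ r * z \<le> Y \<and> (\<exists>w>0. m + n * w = v ^ r * z)}"
  define wt where "wt = (\<lambda>(v, z). (v ^ r * z - m) div n)"
  define T where "T = (\<lambda>(v, z). {t. 0 < t \<and> t < v \<and> t dvd wt (v, z)})"
  define S where "S = (\<lambda>(v, z) t. (\<lambda>b. (int (wt (v, z) div t * v), int b)) `
     {b \<in> {1..N}. m + n * (wt (v, z) div t * v) dvd b * (t ^ r * (v ^ r * z))})"
  define g where "g = real N * (real m * real Y powr (2/3))"
  have wt: "wt (v, z) = w" if "m + n * w = v ^ r * z" for v z w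
    using assms(3) by (simp add: wt_def flip: that)
  have finI: "finite I"
    by (rule finite_subset[of _ "{1..Y} \<times> {1..Y}"]) (auto simp: I_def)
  have finT: "finite (T i)" for i
    by (cases i) (auto simp: T_def)
  have finS: "finite (S i t)" for i t
    by (cases i) (auto simp: S_def)
  have "{(a, b) \<in> local_defect_set (monom 1 r * [:int m, int n:]). 1 \<le> a \<and> of_int a \<le> X \<and> 1 \<le> b \<and> of_int b \<le> X}
      \<subseteq> (\<Union>i\<in>I. \<Union>t\<in>T i. S i t)"
  proof safe
    fix a b assume ab: "(a, b) \<in> local_defect_set (monom 1 r * [:int m, int n:])"
      "1 \<le> a" "of_int a \<le> X" "1 \<le> b" "of_int b \<le> X"
    have "a \<le> int N" "b \<le> int N"
      using ab by (auto simp: N_def le_floor_iff le_nat_iff)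
    then obtain v z w t b' where *: "1 \<le> z" "0 < w" "0 < t" "t < v" "t dvd w"
      "m + n * w = v ^ r * z" "v ^ r * z \<le> m + n * N"
      "a = int (w div t * v)" "b = int b'" "b' \<in> {1..N}"
      "m + n * (w div t * v) dvd b' * (t ^ r * (v ^ r * z))"
      using defect_point_cover[OF assms(2,3) ab(1,2) _ ab(4)] by metis
    have "v ^ r * z \<le> Y"
      using *(7) by (simp add: Y_def N_def)
    moreover have "v \<le> v ^ r * z"
    proof -
      have "v * 1 \<le> v ^ r * z"
        using * assms(4) by (intro mult_le_mono self_le_power) auto
      then show ?thesis by simp
    qed
    moreover have "1 * z \<le> v ^ r * z"
      using * by (intro mult_le_mono) auto
    ultimately have "v \<le> Y" "z \<le> Y" "v ^ r * z \<le> Y"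
      by linarith+
    then have "(v, z) \<in> I"
      using * unfolding I_def by auto
    moreover have "t \<in> T (v, z)"
      using * by (simp add: T_def wt[OF *(6)])
    moreover have "(a, b) \<in> S (v, z) t"
      using * by (auto simp: S_def wt[OF *(6)])
    ultimately show "(a, b) \<in> (\<Union>i\<in>I. \<Union>t\<in>T i. S i t)"
      by blast
  qed
  then have "defect_count (monom 1 r * [:int m, int n:]) X \<le> card (\<Union>i\<in>I. \<Union>t\<in>T i. S i t)"
    unfolding defect_count_def using finI finT finS by (intro card_mono finite_UN_I) auto
  also have "\<dots> \<le> (\<Sum>i\<in>I. card (\<Union>t\<in>T i. S i t))"
    by (rule card_UN_le[OF finI])
  also have "\<dots> \<le> (\<Sum>i\<in>I. \<Sum>t\<in>T i. card (S i t))"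
    by (intro sum_mono card_UN_le finT)
  finally have "real (defect_count (monom 1 r * [:int m, int n:]) X) \<le> real (\<Sum>i\<in>I. \<Sum>t\<in>T i. card (S i t))"
    by (simp only: of_nat_le_iff)
  also have "\<dots> = (\<Sum>i\<in>I. \<Sum>t\<in>T i. real (card (S i t)))"
    by simp
  also have "\<dots> \<le> (\<Sum>(v, z)\<in>I. (C * real Y powr \<delta>) * (g * (1 / (real v * real z))))"
  proof (rule sum_mono, clarify)
    fix v z assume vz: "(v, z) \<in> I"
    then obtain w where w: "w > 0" "m + n * w = v ^ r * z" "1 \<le> v" "1 \<le> z" "v ^ r * z \<le> Y"
      by (auto simp: I_def)
    have "w \<le> n * w"
      using assms(3) by simp
    then have "w \<le> Y"
      using w(2,5) by linarith
    have card_S: "real (card (S (v, z) t)) \<le> g * (1 / (real v * real z))" if "t \<in> T (v, z)" for t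
    proof -
      have t: "0 < t" "t < v" "t dvd w"
        using that by (auto simp: T_def wt[OF w(2)])
      have "card (S (v, z) t) \<le> card {b \<in> {1..N}. m + n * (w div t * v) dvd b * (t ^ r * (v ^ r * z))}"
        unfolding S_def wt[OF w(2)] prod.case by (rule card_image_le) simp
      then have "real (card (S (v, z) t)) \<le> real (card {b \<in> {1..N}. m + n * (w div t * v) dvd b * (t ^ r * (v ^ r * z))})"
        by (simp only: of_nat_le_iff)
      also have "\<dots> \<le> real N * (real m * real Y powr (2/3) * (1 / (real v * real z)))"
        by (rule defect_count_fibre_bound[OF assms(1-4) t w(4,2,5)])
      finally show ?thesis
        by (simp add: g_def)
    qed
    have "card (T (v, z)) \<le> card {d. d dvd w}"
      using w(1) by (intro card_mono) (auto simp: T_def wt[OF w(2)])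
    then have "real (card (T (v, z))) \<le> C * real w powr \<delta>"
      using div[OF w(1)] by linarith
    also have "\<dots> \<le> C * real Y powr \<delta>"
      using \<open>w \<le> Y\<close> assms(6,7) by (intro mult_left_mono powr_mono2) auto
    finally have card_T: "real (card (T (v, z))) \<le> C * real Y powr \<delta>" .
    have "(\<Sum>t\<in>T (v, z). real (card (S (v, z) t))) \<le> (\<Sum>t\<in>T (v, z). g * (1 / (real v * real z)))"
      by (intro sum_mono card_S)
    also have "\<dots> = real (card (T (v, z))) * (g * (1 / (real v * real z)))"
      by simp
    also have "\<dots> \<le> (C * real Y powr \<delta>) * (g * (1 / (real v * real z)))"
      using card_T by (intro mult_right_mono) (auto simp: g_def)
    finally show "(\<Sum>t\<in>T (v, z). real (card (S (v, z) t))) \<le> (C * real Y powr \<delta>) * (g * (1 / (real v * real z)))" .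
  qed
  also have "\<dots> \<le> (\<Sum>(v, z)\<in>{1..Y} \<times> {1..Y}. (C * real Y powr \<delta>) * (g * (1 / (real v * real z))))"
    using assms(6) by (intro sum_mono2) (auto simp: I_def g_def)
  also have "\<dots> = (C * real Y powr \<delta>) * g * (\<Sum>(v, z)\<in>{1..Y} \<times> {1..Y}. inverse (real v) * inverse (real z))"
    by (simp add: sum_distrib_left case_prod_unfold divide_inverse mult_ac)
  also have "(\<Sum>(v, z)\<in>{1..Y} \<times> {1..Y}. inverse (real v) * inverse (real z)) = (harm Y)\<^sup>2"
    by (simp add: harm_def power2_eq_square sum_product sum.cartesian_product)
  finally show ?thesis
    by (simp add: g_def)
qed

lemma defect_count_upper_bound:
  fixes m n r :: nat and \<epsilon> :: real
  assumes "coprime m n" "1 \<le> m" "1 \<le> n" "2 \<le> r" "\<epsilon> > 0"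
  shows "(\<lambda>X. real (defect_count (monom 1 r * [:int m, int n:]) X)) \<in> O(\<lambda>X. X powr (5/3 + \<epsilon>))"
proof -
  \<comment> \<open>One power of Y^\<open>\<delta>\<close> is lost to the divisor bound and one to each of the two harmonic numbers.\<close>
  define \<delta> where "\<delta> = \<epsilon> / 3"
  have "\<delta> > 0"
    using assms by (simp add: \<delta>_def)
  obtain C where C: "C \<ge> 1" "\<And>k::nat. k > 0 \<Longrightarrow> real (card {d. d dvd k}) \<le> C * real k powr \<delta>"
    using divisor_bound[OF \<open>\<delta> > 0\<close>] by blast
  define D where "D = 1 + 1 / \<delta>"
  have "D > 0"
    using \<open>\<delta> > 0\<close> by (simp add: D_def add_pos_pos)
  define A where "A = C * real m * D\<^sup>2 * real (m + n) powr (2/3 + \<epsilon>)"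
  show ?thesis
  proof (rule landau_o.bigI)
    show "A > 0"
      using C(1) assms \<open>D > 0\<close> by (simp add: A_def)
    show "\<forall>\<^sub>F X in at_top. norm (real (defect_count (monom 1 r * [:int m, int n:]) X)) \<le> A * norm (X powr (5/3 + \<epsilon>))"
      using eventually_ge_at_top[of 1]
    proof eventually_elim
      case (elim X)
      define N where "N = nat \<lfloor>X\<rfloor>"
      define Y where "Y = m + n * N"
      have N: "real N \<le> X"
        using elim by (simp add: N_def)
      have "real m * 1 + real n * real N \<le> real m * X + real n * X"
        using N elim by (intro add_mono mult_left_mono) auto
      then have Y: "real Y \<le> real (m + n) * X" "Y \<ge> 1"
        using assms by (auto simp: Y_def distrib_right)
      have "harm Y \<le> D * real Y powr \<delta>"
        unfolding D_def by (rule harm_le_powr[OF \<open>\<delta> > 0\<close> Y(2)])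
      then have harm: "(harm Y)\<^sup>2 \<le> (D * real Y powr \<delta>)\<^sup>2"
        by (intro power_mono) (auto simp: harm_nonneg)
      have powr_Y: "real Y powr \<delta> * real Y powr (2/3) * (real Y powr \<delta> * real Y powr \<delta>) = real Y powr (2/3 + \<epsilon>)"
        by (simp add: \<delta>_def add_ac flip: powr_add)
      have "real Y powr (2/3 + \<epsilon>) \<le> (real (m + n) * X) powr (2/3 + \<epsilon>)"
        using Y assms by (intro powr_mono2) auto
      then have Y_le: "real Y powr (2/3 + \<epsilon>) \<le> real (m + n) powr (2/3 + \<epsilon>) * X powr (2/3 + \<epsilon>)"
        by (simp only: powr_mult)
      have powr_X: "X * X powr (2/3 + \<epsilon>) = X powr (5/3 + \<epsilon>)"
        using powr_add[of X 1 "2/3 + \<epsilon>"] elim by simp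
      have "real (defect_count (monom 1 r * [:int m, int n:]) X)
          \<le> (C * real Y powr \<delta>) * (real N * (real m * real Y powr (2/3))) * (harm Y)\<^sup>2"
        unfolding N_def Y_def by (rule defect_count_le[OF assms(1-4) C(2) _ \<open>\<delta> > 0\<close>]) (use C(1) in auto)
      also have "\<dots> \<le> (C * real Y powr \<delta>) * (X * (real m * real Y powr (2/3))) * (D * real Y powr \<delta>)\<^sup>2"
        using N elim C(1) by (intro mult_mono[OF _ harm] mult_left_mono mult_right_mono) auto
      also have "\<dots> = C * real m * D\<^sup>2 * X * real Y powr (2/3 + \<epsilon>)"
        unfolding powr_Y[symmetric] by (simp add: power2_eq_square mult_ac)
      also have "\<dots> \<le> C * real m * D\<^sup>2 * X * (real (m + n) powr (2/3 + \<epsilon>) * X powr (2/3 + \<epsilon>))"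
        using C(1) elim by (intro mult_left_mono Y_le) auto
      also have "\<dots> = A * X powr (5/3 + \<epsilon>)"
        unfolding powr_X[symmetric] A_def by (simp only: mult_ac)
      finally show ?case
        by simp
    qed
  qed
qed

section \<open>The growth of the defect count\<close>

theorem theorem1p7:
  "(\<forall>P :: int poly.
      lead_coeff P = 1 \<and> degree P \<ge> 2 \<and> (\<forall>i. coeff P i \<ge> 0) \<and> poly P 0 = 0 \<and>
      P \<noteq> monom 1 (degree P) \<longrightarrow>
      (\<lambda>X::real. real (defect_count P X)) \<in> \<Omega>[at_top](\<lambda>X. X)) \<and>
   (\<forall>(r::nat) (m::int) (n::int) (P :: int poly).
      r \<ge> 2 \<and> m \<ge> 1 \<and> n \<ge> 1 \<and> coprime m n \<and> P = monom 1 r * [:m, n:] \<longrightarrow>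
      (\<lambda>X::real. real (defect_count P X)) \<in> \<Omega>[at_top](\<lambda>X. X * ln X) \<and>
      (\<forall>\<epsilon>::real. \<epsilon> > 0 \<longrightarrow>
        (\<lambda>X::real. real (defect_count P X)) \<in> O[at_top](\<lambda>X. X powr (7/4 + \<epsilon>))) \<and>
      (r = 2 \<longrightarrow> (\<forall>\<epsilon>::real. \<epsilon> > 0 \<longrightarrow>
        (\<lambda>X::real. real (defect_count P X)) \<in> O[at_top](\<lambda>X. X powr (5/3 + \<epsilon>)))))"
proof (intro conjI allI impI)
  fix P :: "int poly"
  assume "lead_coeff P = 1 \<and> degree P \<ge> 2 \<and> (\<forall>i. coeff P i \<ge> 0) \<and> poly P 0 = 0 \<and>
      P \<noteq> monom 1 (degree P)"
  then show "(\<lambda>X. real (defect_count P X)) \<in> \<Omega>(\<lambda>X. X)"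
    by (intro linear_lower_bound_monic) auto
next
  fix r :: nat and m n :: int and P :: "int poly"
  assume *: "r \<ge> 2 \<and> m \<ge> 1 \<and> n \<ge> 1 \<and> coprime m n \<and> P = monom 1 r * [:m, n:]"
  define m' n' where "m' = nat m" and "n' = nat n"
  have int: "m = int m'" "n = int n'"
    using * by (auto simp: m'_def n'_def)
  have P: "P = monom 1 r * [:int m', int n':]"
    using * int by simp
  have mn: "1 \<le> m'" "1 \<le> n'" "coprime m' n'" "2 \<le> r"
    using * unfolding int by auto
  show "(\<lambda>X. real (defect_count P X)) \<in> \<Omega>(\<lambda>X. X * ln X)"
    unfolding P using mn by (intro defect_count_lower_bound) auto
  have upper: "(\<lambda>X. real (defect_count P X)) \<in> O(\<lambda>X. X powr (5/3 + \<epsilon>))" if "\<epsilon> > 0" for \<epsilon> :: real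
    unfolding P using mn that by (intro defect_count_upper_bound) auto
  show "(\<lambda>X. real (defect_count P X)) \<in> O(\<lambda>X. X powr (5/3 + \<epsilon>))" if "\<epsilon> > 0" for \<epsilon> :: real
    using upper[OF that] .
  show "(\<lambda>X. real (defect_count P X)) \<in> O(\<lambda>X. X powr (7/4 + \<epsilon>))" if "\<epsilon> > 0" for \<epsilon> :: real
  proof -
    have "(\<lambda>X::real. X powr (5/3 + \<epsilon>)) \<in> O(\<lambda>X. X powr (7/4 + \<epsilon>))"
      by (rule landau_o.big_mono, use eventually_ge_at_top[of 1] in eventually_elim) (auto intro: powr_mono)
    then show ?thesis
      using upper[OF that] landau_o.big_trans by blast
  qed
qed

end
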